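(* Let $X\subseteq\mathbf C$. (1) If $X$ has $\mathcal M_{\mathrm{UP}}$-measure 0, then $X$ has #P-measure 0. (2) If $X$ has $\mathcal M_{\mathrm{NP}}$-measure 0, then $X$ has SpanP-measure 0. (3) If $X$ has $\mathcal M_{\mathrm{SPP}}$-measure 0, then $X$ has GapP-measure 0.
   Context: $\mathbf C=\{0,1\}^\infty$ is Cantor space; $S\upharpoonright n$ is the length-$n$ prefix. For $A\subseteq\{0,1\}^*$, $A_{=n}=A\cap\{0,1\}^n$ and $A^{\mathrm{i.o.}}=\{S:S\upharpoonright n\in A\text{ for infinitely many }n\}$. A series $\sum_n a_n$ of nonnegative reals is p-convergent if there is a polynomial-time computable $m:\mathbb N\to\mathbb N$ (input in unary) with $\sum_{n\ge m(i)}a_n\le2^{-i}$ for all $i$. For a complexity class $\mathcal C$, $X$ has $\mathcal M_{\mathcal C}$-measure 0 if there exist $A\in\mathcal C$ and polynomial-time computable $f$ such that $X\subseteq A^{\mathrm{i.o.}}$, $\log|A_{=n}|<n-f(n)$ for all sufficiently large $n$, and $\sum_n 2^{-f(n)}$ is p-convergent. SPP is the class of languages whose characteristic function is a GapP function. A martingale is $d:\{0,1\}^*\to[0,\infty)$ with $d(w)=\frac{d(w0)+d(w1)}{2}$; it succeeds on $S$ if $\limsup_n d(S\upharpoonright n)=\infty$. #P functions count accepting paths of a polynomial-time nondeterministic Turing machine; SpanP functions count the distinct outputs of a polynomial-time nondeterministic machine that outputs a string or nothing on each path; GapP functions are accepting minus rejecting path counts. For $\Delta\in\{\#\mathrm P,\mathrm{SpanP},\mathrm{GapP}\}$,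 a $\Delta$-martingale is a martingale $d$ for which there are $f\in\Delta$ and polynomial-time computable $g$ with power-of-2 values with $|d(w)-f(w,r)/g(w,r)|\le2^{-r}$ for all $w$ and $r\in\mathbb N$ ($r$ in unary); $X$ has $\Delta$-measure 0 if some $\Delta$-martingale succeeds on every element of $X$. *)

theory Defs
  imports
    Complex_Main
    "HOL-Library.Extended_Real"
    "HOL-Library.Liminf_Limsup"
    "HOL-Computational_Algebra.Polynomial"
begin

section \<open>Multi-tape nondeterministic Turing machines\<close>

text \<open>Tapes are two-way infinite. Tape 0 carries the input, tape 1 the output.
  The state set and the tape alphabet are those mentioned in the finite transition table,
  so they are finite although their ambient types are not.\<close>

datatype symbol = Blank | Bit bool | Mark nat

datatype move = MoveLeft | Stay | MoveRight

record 'q ntm =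
  tape_count :: nat
  start_state :: 'q
  accept_states :: "'q set"
  table :: "('q \<times> symbol list \<times> 'q \<times> (symbol \<times> move) list) set"

type_synonym tape = "(int \<Rightarrow> symbol) \<times> int"
type_synonym 'q config = "'q \<times> tape list"

definition wf_ntm :: "'q ntm \<Rightarrow> bool" where
  "wf_ntm M \<longleftrightarrow> 2 \<le> tape_count M \<and> finite (table M) \<and>
     (\<forall>(q, rs, q', as) \<in> table M. length rs = tape_count M \<and> length as = tape_count M)"

definition deterministic :: "'q ntm \<Rightarrow> bool" where
  "deterministic M \<longleftrightarrow>
     (\<forall>q rs q1 as1 q2 as2. (q, rs, q1, as1) \<in> table M \<and> (q, rs, q2, as2) \<in> table M
        \<longrightarrow> q1 = q2 \<and> as1 = as2)"

fun head_shift :: "move \<Rightarrow> int" where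
  "head_shift MoveLeft = - 1"
| "head_shift Stay = 0"
| "head_shift MoveRight = 1"

definition tape_read :: "tape \<Rightarrow> symbol" where
  "tape_read t = fst t (snd t)"

definition tape_act :: "symbol \<times> move \<Rightarrow> tape \<Rightarrow> tape" where
  "tape_act a t = ((fst t)(snd t := fst a), snd t + head_shift (snd a))"

definition blank_tape :: tape where
  "blank_tape = (\<lambda>_. Blank, 0)"

definition input_tape :: "bool list \<Rightarrow> tape" where
  "input_tape x = (\<lambda>i. if 0 \<le> i \<and> i < int (length x) then Bit (x ! nat i) else Blank, 0)"

definition init_config :: "'q ntm \<Rightarrow> bool list \<Rightarrow> 'q config" where
  "init_config M x = (start_state M, input_tape x # replicate (tape_count M - 1) blank_tape)"

definition ntm_step :: "'q ntm \<Rightarrow> 'q config \<Rightarrow> 'q config \<Rightarrow> bool" where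
  "ntm_step M c c' \<longleftrightarrow>
     (\<exists>q' as. (fst c, map tape_read (snd c), q', as) \<in> table M \<and>
        c' = (q', map2 tape_act as (snd c)))"

text \<open>Different table entries applicable to a configuration lead to different configurations
  (they differ in the state, a written symbol or a head position), so sequences of configurations
  correspond bijectively to sequences of nondeterministic choices.\<close>

definition computation :: "'q ntm \<Rightarrow> bool list \<Rightarrow> 'q config list \<Rightarrow> bool" where
  "computation M x cs \<longleftrightarrow> cs \<noteq> [] \<and> hd cs = init_config M x \<and> successively (ntm_step M) cs"

definition halted :: "'q ntm \<Rightarrow> 'q config \<Rightarrow> bool" where
  "halted M c \<longleftrightarrow> \<not> (\<exists>c'. ntm_step M c c')"

definition paths :: "'q ntm \<Rightarrow> bool list \<Rightarrow> 'q config list set" where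
  "paths M x = {cs. computation M x cs \<and> halted M (last cs)}"

definition accepting_paths :: "'q ntm \<Rightarrow> bool list \<Rightarrow> 'q config list set" where
  "accepting_paths M x = {cs \<in> paths M x. fst (last cs) \<in> accept_states M}"

definition rejecting_paths :: "'q ntm \<Rightarrow> bool list \<Rightarrow> 'q config list set" where
  "rejecting_paths M x = {cs \<in> paths M x. fst (last cs) \<notin> accept_states M}"

text \<open>The output is the maximal block of bits on tape 1 that starts at cell 0.\<close>

definition outputs :: "'q config \<Rightarrow> bool list \<Rightarrow> bool" where
  "outputs c y \<longleftrightarrow>
     (\<forall>i < length y. fst (snd c ! 1) (int i) = Bit (y ! i)) \<and>
     fst (snd c ! 1) (int (length y)) \<notin> range Bit"

definition poly_time :: "'q ntm \<Rightarrow> bool" where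
  "poly_time M \<longleftrightarrow>
     (\<exists>p :: nat poly. \<forall>x cs. computation M x cs \<longrightarrow> length cs \<le> poly p (length x))"

section \<open>Complexity classes\<close>

definition poly_ntm :: "nat ntm \<Rightarrow> bool" where
  "poly_ntm M \<longleftrightarrow> wf_ntm M \<and> poly_time M"

definition FP :: "(bool list \<Rightarrow> bool list) set" where
  "FP = {h. \<exists>M. poly_ntm M \<and> deterministic M \<and>
              (\<forall>x. \<forall>cs \<in> paths M x. outputs (last cs) (h x))}"

definition NP :: "bool list set set" where
  "NP = {A. \<exists>M. poly_ntm M \<and> (\<forall>x. x \<in> A \<longleftrightarrow> accepting_paths M x \<noteq> {})}"

definition UP :: "bool list set set" where
  "UP = {A. \<exists>M. poly_ntm M \<and> (\<forall>x. x \<in> A \<longleftrightarrow> accepting_paths M x \<noteq> {}) \<and>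
              (\<forall>x. card (accepting_paths M x) \<le> 1)}"

text \<open>All counting functions are regarded as integer-valued.\<close>

definition SharpP :: "(bool list \<Rightarrow> int) set" where
  "SharpP = {f. \<exists>M. poly_ntm M \<and> (\<forall>x. f x = int (card (accepting_paths M x)))}"

text \<open>A path outputs a string if it accepts, and nothing if it rejects.\<close>

definition SpanP :: "(bool list \<Rightarrow> int) set" where
  "SpanP = {f. \<exists>M. poly_ntm M \<and>
              (\<forall>x. f x = int (card {y. \<exists>cs \<in> accepting_paths M x. outputs (last cs) y}))}"

definition GapP :: "(bool list \<Rightarrow> int) set" where
  "GapP = {f. \<exists>M. poly_ntm M \<and>
             (\<forall>x. f x = int (card (accepting_paths M x)) - int (card (rejecting_paths M x)))}"

definition SPP :: "bool list set set" where
  "SPP = {A. (\<lambda>x. if x \<in> A then 1 else 0) \<in> GapP}"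

section \<open>Encodings of numbers and pairs\<close>

definition unary :: "nat \<Rightarrow> bool list" where
  "unary n = replicate n False"

fun binary :: "nat \<Rightarrow> bool list" where
  "binary n = (if n < 2 then [n = 1] else binary (n div 2) @ [odd n])"

declare binary.simps [simp del]

text \<open>The pair of a string \<open>w\<close> and a number \<open>r\<close> in unary is encoded as \<open>0\<^sup>r1w\<close>.\<close>

definition pair_unary :: "bool list \<Rightarrow> nat \<Rightarrow> bool list" where
  "pair_unary w r = unary r @ True # w"

definition poly_computable_unary_to_unary :: "(nat \<Rightarrow> nat) \<Rightarrow> bool" where
  "poly_computable_unary_to_unary m \<longleftrightarrow> (\<exists>h \<in> FP. \<forall>n. h (unary n) = unary (m n))"

definition poly_computable_unary_to_binary :: "(nat \<Rightarrow> nat) \<Rightarrow> bool" where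
  "poly_computable_unary_to_binary f \<longleftrightarrow> (\<exists>h \<in> FP. \<forall>n. h (unary n) = binary (f n))"

definition poly_computable_pair_to_binary :: "(bool list \<Rightarrow> nat \<Rightarrow> nat) \<Rightarrow> bool" where
  "poly_computable_pair_to_binary g \<longleftrightarrow>
     (\<exists>h \<in> FP. \<forall>w r. h (pair_unary w r) = binary (g w r))"

section \<open>Measure notions on Cantor space\<close>

type_synonym cantor = "nat \<Rightarrow> bool"

definition restrict_to :: "cantor \<Rightarrow> nat \<Rightarrow> bool list" where
  "restrict_to S n = map S [0..<n]"

definition slice :: "bool list set \<Rightarrow> nat \<Rightarrow> bool list set" where
  "slice A n = {x \<in> A. length x = n}"

definition inf_often :: "bool list set \<Rightarrow> cantor set" where
  "inf_often A = {S. infinite {n. restrict_to S n \<in> A}}"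

text \<open>The modulus takes its argument and returns its value in unary, following the usual
  identification of \<open>\<nat>\<close> with \<open>{0}\<^sup>*\<close>; so it is polynomially bounded.\<close>

definition p_convergent :: "(nat \<Rightarrow> real) \<Rightarrow> bool" where
  "p_convergent a \<longleftrightarrow> summable a \<and>
     (\<exists>m. poly_computable_unary_to_unary m \<and> (\<forall>i. (\<Sum>n. a (n + m i)) \<le> 2 powr (- real i)))"

text \<open>The disjunct \<open>slice A n = {}\<close> implements the convention \<open>log 0 = -\<infinity>\<close>.\<close>

definition M_measure_zero :: "bool list set set \<Rightarrow> cantor set \<Rightarrow> bool" where
  "M_measure_zero C X \<longleftrightarrow>
     (\<exists>A \<in> C. \<exists>f. poly_computable_unary_to_binary f \<and>
        X \<subseteq> inf_often A \<and>
        (\<forall>\<^sub>F n in sequentially.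
           slice A n = {} \<or> log 2 (real (card (slice A n))) < real n - real (f n)) \<and>
        p_convergent (\<lambda>n. 2 powr (- real (f n))))"

definition martingale :: "(bool list \<Rightarrow> real) \<Rightarrow> bool" where
  "martingale d \<longleftrightarrow>
     (\<forall>w. 0 \<le> d w) \<and> (\<forall>w. d w = (d (w @ [False]) + d (w @ [True])) / 2)"

definition succeeds_on :: "(bool list \<Rightarrow> real) \<Rightarrow> cantor \<Rightarrow> bool" where
  "succeeds_on d S \<longleftrightarrow> limsup (\<lambda>n. ereal (d (restrict_to S n))) = \<infinity>"

definition class_martingale :: "(bool list \<Rightarrow> int) set \<Rightarrow> (bool list \<Rightarrow> real) \<Rightarrow> bool" where
  "class_martingale \<Delta> d \<longleftrightarrow> martingale d \<and>
     (\<exists>f \<in> \<Delta>. \<exists>g. poly_computable_pair_to_binary g \<and>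
        (\<forall>w r. \<exists>k. g w r = 2 ^ k) \<and>
        (\<forall>w r. \<bar>d w - real_of_int (f (pair_unary w r)) / real (g w r)\<bar> \<le> 2 powr (- real r)))"

definition class_measure_zero :: "(bool list \<Rightarrow> int) set \<Rightarrow> cantor set \<Rightarrow> bool" where
  "class_measure_zero \<Delta> X \<longleftrightarrow> (\<exists>d. class_martingale \<Delta> d \<and> (\<forall>S \<in> X. succeeds_on d S))"

end

theory Submission
  imports Defs "HOL-Library.Multiset" "HOL-Library.Countable"
begin

text \<open>
  Let \<open>d\<^sub>n(w)\<close> be the probability that a random infinite extension of \<open>w\<close> has its length-\<open>n\<close>
  prefix in \<open>A\<close>. The martingale \<open>d = \<Sum>\<^sub>n d\<^sub>n\<close> is finite because \<open>d\<^sub>n(\<lambda>) \<le> 2\<^bsup>-f(n)\<^esup>\<close> for large \<open>n\<close>, and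
  it succeeds on every sequence with infinitely many prefixes in \<open>A\<close>, since \<open>d(w)\<close> is at least the
  number of prefixes of \<open>w\<close> that lie in \<open>A\<close>.

  For any \<open>N\<close>, the sum \<open>\<Sum>\<^bsub>n \<le> |w|+N\<^esub> d\<^sub>n(w)\<close> is \<open>2\<^bsup>-N\<^esup>\<close> times the number of pairs \<open>(y, n)\<close> such that
  \<open>|y| = N\<close> and the length-\<open>n\<close> prefix of \<open>wy\<close> is in \<open>A\<close>. A nondeterministic machine guesses \<open>y\<close> and
  \<open>n\<close> and then runs the machine for \<open>A\<close> on that prefix; its accepting paths, its distinct outputs
  (when it prints the guesses) or its gap count these pairs in the three cases.

  The number \<open>N\<close> of guesses must be the same on all paths, at least the modulus of convergence, and
  such that \<open>2\<^sup>N\<close> is computable in polynomial time. All this holds for the running time of the machine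
  that computes the modulus: a machine takes at least as many steps as its output is long, and
  running it as a clock produces one guess (or one zero of the binary numeral \<open>2\<^sup>N\<close>) per step.
\<close>

section \<open>Runs of finitely branching transition systems\<close>

definition halts :: "('c \<Rightarrow> 'c \<Rightarrow> bool) \<Rightarrow> 'c \<Rightarrow> bool" where
  "halts R c \<longleftrightarrow> (\<nexists>c'. R c c')"

definition runs :: "('c \<Rightarrow> 'c \<Rightarrow> bool) \<Rightarrow> 'c \<Rightarrow> 'c list set" where
  "runs R c = {cs. cs \<noteq> [] \<and> hd cs = c \<and> successively R cs \<and> halts R (last cs)}"

text \<open>Unfinished runs are bounded as well, so that a bound excludes infinite branches and
  allows induction on the tree. It counts configurations, one more than steps.\<close>

definition run_bound :: "('c \<Rightarrow> 'c \<Rightarrow> bool) \<Rightarrow> 'c \<Rightarrow> nat \<Rightarrow> bool" where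
  "run_bound R c k \<longleftrightarrow>
     (\<forall>cs. cs \<noteq> [] \<and> hd cs = c \<and> successively R cs \<longrightarrow> length cs \<le> k)"

text \<open>One additive quantity serves all three classes: an indicator of acceptance gives path
  counts, a sign gives the gap, and an indicator of a fixed output detects that output.\<close>

definition run_sum :: "('c \<Rightarrow> 'c \<Rightarrow> bool) \<Rightarrow> ('c \<Rightarrow> int) \<Rightarrow> 'c \<Rightarrow> int" where
  "run_sum R \<phi> c = (\<Sum>cs \<in> runs R c. \<phi> (last cs))"

text \<open>\<open>unfolds R c t F\<close>: the computation tree below \<open>c\<close> can be cut, at depth at most \<open>t\<close>, so that the
  leaves of the upper part are \<open>F\<close>, counted with multiplicity.\<close>

inductive unfolds :: "('c \<Rightarrow> 'c \<Rightarrow> bool) \<Rightarrow> 'c \<Rightarrow> nat \<Rightarrow> 'c multiset \<Rightarrow> bool" for R where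
  leaf: "unfolds R c t {#c#}"
| node: "\<exists>c'. R c c' \<Longrightarrow> (\<And>c'. R c c' \<Longrightarrow> unfolds R c' t (F c'))
    \<Longrightarrow> unfolds R c (Suc t) (\<Sum>c' | R c c'. F c')"

lemma run_bound_0: "\<not> run_bound R c 0"
  unfolding run_bound_def by (auto intro!: exI[of _ "[c]"])

lemma run_bound_mono: "run_bound R c k \<Longrightarrow> k \<le> l \<Longrightarrow> run_bound R c l"
  by (force simp: run_bound_def)

lemma run_bound_Suc:
  "run_bound R c (Suc k) \<longleftrightarrow> (\<forall>c'. R c c' \<longrightarrow> run_bound R c' k)"
proof
  assume L: "run_bound R c (Suc k)"
  show "\<forall>c'. R c c' \<longrightarrow> run_bound R c' k"
  proof (intro allI impI)
    fix c' assume "R c c'"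
    show "run_bound R c' k"
      unfolding run_bound_def
    proof (intro allI impI)
      fix cs assume "cs \<noteq> [] \<and> hd cs = c' \<and> successively R cs"
      with \<open>R c c'\<close> L[unfolded run_bound_def, rule_format, of "c # cs"]
      show "length cs \<le> k" by (auto simp: successively_Cons)
    qed
  qed
next
  assume R: "\<forall>c'. R c c' \<longrightarrow> run_bound R c' k"
  show "run_bound R c (Suc k)"
    unfolding run_bound_def
  proof (intro allI impI)
    fix cs assume cs: "cs \<noteq> [] \<and> hd cs = c \<and> successively R cs"
    then obtain ds where ds: "cs = c # ds" by (cases cs) auto
    show "length cs \<le> Suc k"
    proof (cases "ds = []")
      case False
      then have "R c (hd ds)" "successively R ds"
        using cs ds by (auto simp: successively_Cons)
      with R False ds show ?thesis by (auto simp: run_bound_def)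
    qed (simp add: ds)
  qed
qed

lemma runs_halted: "halts R c \<Longrightarrow> runs R c = {[c]}"
proof -
  assume h: "halts R c"
  have "cs = [c]" if "cs \<in> runs R c" for cs
    using that h by (cases cs) (auto simp: runs_def halts_def successively_Cons)
  moreover have "[c] \<in> runs R c" using h by (simp add: runs_def)
  ultimately show ?thesis by blast
qed

lemma runs_step:
  assumes "\<not> halts R c"
  shows "runs R c = (\<Union>c' \<in> {c'. R c c'}. (#) c ` runs R c')"
proof (intro equalityI subsetI)
  fix cs assume cs: "cs \<in> runs R c"
  then obtain ds where ds: "cs = c # ds" by (cases cs) (auto simp: runs_def)
  have "ds \<noteq> []" using cs ds assms by (auto simp: runs_def)
  then have "R c (hd ds)" "ds \<in> runs R (hd ds)"
    using cs ds by (auto simp: runs_def successively_Cons)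
  then show "cs \<in> (\<Union>c' \<in> {c'. R c c'}. (#) c ` runs R c')" using ds by blast
qed (auto simp: runs_def successively_Cons)

lemma finite_runs:
  assumes "\<And>c. finite {c'. R c c'}"
  shows "run_bound R c k \<Longrightarrow> finite (runs R c)"
proof (induction k arbitrary: c)
  case (Suc k)
  then show ?case
    by (cases "halts R c")
      (auto simp: runs_halted runs_step run_bound_Suc assms)
qed (simp add: run_bound_0)

lemma runs_nonempty: "run_bound R c k \<Longrightarrow> runs R c \<noteq> {}"
proof (induction k arbitrary: c)
  case (Suc k)
  show ?case
  proof (cases "halts R c")
    case False
    then obtain c' where "R c c'" by (auto simp: halts_def)
    with Suc show ?thesis using runs_step[OF False] by (auto simp: run_bound_Suc)
  qed (simp add: runs_halted)
qed (simp add: run_bound_0)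

lemma run_sum_halted: "halts R c \<Longrightarrow> run_sum R \<phi> c = \<phi> c"
  by (simp add: run_sum_def runs_halted)

text \<open>The runs from \<open>c\<close> are partitioned by their second configuration, and
  removing \<open>c\<close> from the front keeps the last configuration. The bound makes all parts
  finite.\<close>

lemma run_sum_step:
  assumes fin: "\<And>c. finite {c'. R c c'}" and bd: "run_bound R c k" and nh: "\<not> halts R c"
  shows "run_sum R \<phi> c = (\<Sum>c' | R c c'. run_sum R \<phi> c')"
proof -
  obtain l where k: "k = Suc l" using bd by (cases k) (auto simp: run_bound_0)
  have f: "finite (runs R c')" if "R c c'" for c'
    using finite_runs[OF fin, where c = c' and k = l] bd that by (simp add: k run_bound_Suc)
  have dj: "(#) c ` runs R c1 \<inter> (#) c ` runs R c2 = {}" if "c1 \<noteq> c2" for c1 c2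
    using that by (auto simp: runs_def)
  have ne: "[] \<notin> runs R c'" for c' by (simp add: runs_def)
  have "run_sum R \<phi> c = (\<Sum>c' | R c c'. \<Sum>cs \<in> (#) c ` runs R c'. \<phi> (last cs))"
    unfolding run_sum_def runs_step[OF nh]
    by (rule sum.UNION_disjoint) (use f dj fin in auto)
  also have "\<dots> = (\<Sum>c' | R c c'. run_sum R \<phi> c')"
    unfolding run_sum_def
    by (rule sum.cong[OF refl]) (auto simp: sum.reindex ne intro!: sum.cong split: if_splits)
  finally show ?thesis .
qed

lemma unfolds_mono: "unfolds R c t F \<Longrightarrow> t \<le> t' \<Longrightarrow> unfolds R c t' F"
proof (induction arbitrary: t' rule: unfolds.induct)
  case (node c t F)
  then obtain s where "t' = Suc s" "t \<le> s" by (cases t') auto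
  with node show ?case by (auto intro!: unfolds.node)
qed (rule unfolds.leaf)

lemma unfolds_one:
  assumes "\<And>c1. R c c1 \<longleftrightarrow> c1 = c'" and "unfolds R c' t F"
  shows "unfolds R c (Suc t) F"
  using unfolds.node[of R c t "\<lambda>_. F"] assms by simp

text \<open>The tree branches over successor configurations, while the intended count is over
  guesses \<open>b\<close>. Injectivity of \<open>f\<close> identifies the two.\<close>

lemma unfolds_branch:
  assumes "\<And>c1. R c c1 \<longleftrightarrow> (\<exists>b \<in> B. c1 = f b)" and inj: "inj_on f B" and "B \<noteq> {}"
    and "\<And>b. b \<in> B \<Longrightarrow> unfolds R (f b) t (F b)"
  shows "unfolds R c (Suc t) (\<Sum>b \<in> B. F b)"
proof -
  have S: "{c1. R c c1} = f ` B" using assms(1) by auto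
  have "unfolds R c (Suc t) (\<Sum>d | R c d. F (inv_into B f d))"
    by (rule unfolds.node) (use assms in auto)
  also have "(\<Sum>d | R c d. F (inv_into B f d)) = (\<Sum>b \<in> B. F b)"
    unfolding S by (subst sum.reindex[OF inj]) (simp add: inj)
  finally show ?thesis .
qed

lemma unfolds_two:
  assumes "\<And>c1. R c c1 \<longleftrightarrow> c1 = c' \<or> c1 = c''" and "c' \<noteq> c''"
    and "unfolds R c' t F'" and "unfolds R c'' t F''"
  shows "unfolds R c (Suc t) (F' + F'')"
proof -
  have "unfolds R c (Suc t) (\<Sum>d \<in> {c', c''}. if d = c' then F' else F'')"
    by (rule unfolds_branch[where f = "\<lambda>d. d"]) (use assms in auto)
  then show ?thesis using assms(2) by simp
qed

lemma unfolds_run_bound: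
  assumes fin: "\<And>c. finite {c'. R c c'}"
  shows "unfolds R c t F \<Longrightarrow> (\<And>s. s \<in># F \<Longrightarrow> run_bound R s k) \<Longrightarrow> run_bound R c (t + k)"
proof (induction rule: unfolds.induct)
  case (leaf c t)
  then show ?case by (auto intro: run_bound_mono)
next
  case (node c t F)
  then show ?case
    using fin by (auto simp: run_bound_Suc set_mset_sum)
qed

text \<open>Iterates \<open>run_sum_step\<close> through the upper part of the tree. It reduces
  counting in a composite machine to counting in the submachines started at the leaves.\<close>

lemma unfolds_run_sum:
  assumes fin: "\<And>c. finite {c'. R c c'}"
  shows "unfolds R c t F \<Longrightarrow> run_bound R c k \<Longrightarrow>
    run_sum R \<phi> c = (\<Sum>s \<in># F. run_sum R \<phi> s)"
proof (induction arbitrary: k rule: unfolds.induct)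
  case (node c t F)
  obtain l where k: "k = Suc l" using node.prems by (cases k) (auto simp: run_bound_0)
  have "(\<Sum>s \<in># (\<Sum>c' | R c c'. F c'). run_sum R \<phi> s) =
      (\<Sum>c' | R c c'. \<Sum>s \<in># F c'. run_sum R \<phi> s)"
    using fin by (induction rule: finite_induct) auto
  also have "\<dots> = (\<Sum>c' | R c c'. run_sum R \<phi> c')"
    using node.IH node.prems by (intro sum.cong refl) (auto simp: k run_bound_Suc)
  finally show ?case
    using node.hyps run_sum_step[OF fin node.prems] by (auto simp: halts_def)
qed simp

text \<open>Every maximal run passes through a leaf, so the output of a run can be read off below
  the leaves.\<close>

lemma unfolds_last:
  assumes fin: "\<And>c. finite {c'. R c c'}"
  shows "unfolds R c t F \<Longrightarrow> cs \<in> runs R c \<Longrightarrow> \<exists>s \<in># F. \<exists>ds \<in> runs R s. last cs = last ds"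
proof (induction arbitrary: cs rule: unfolds.induct)
  case (node c t F)
  have "\<not> halts R c" using node.hyps by (auto simp: halts_def)
  then obtain c' ds where c': "R c c'" "ds \<in> runs R c'" "cs = c # ds"
    using node.prems by (auto simp: runs_step)
  then obtain s es where "s \<in># F c'" "es \<in> runs R s" "last ds = last es"
    using node.IH by blast
  moreover have "last cs = last ds" using c' by (auto simp: runs_def)
  ultimately show ?case
    using c' fin by (auto simp: set_mset_sum)
qed auto

lemma simulation_run_bound:
  assumes "\<And>c d. I c \<Longrightarrow> R' (f c) d \<longleftrightarrow> (\<exists>c'. R c c' \<and> d = f c')"
    and "\<And>c c'. I c \<Longrightarrow> R c c' \<Longrightarrow> I c'"
  shows "run_bound R c k \<Longrightarrow> I c \<Longrightarrow> run_bound R' (f c) k"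
  by (induction k arbitrary: c) (auto simp: run_bound_0 run_bound_Suc assms)

text \<open>An injective map that matches successors in both directions carries the tree below
  \<open>c\<close> isomorphically to the tree below \<open>f c\<close>. The invariant
  \<open>I\<close> will say that the number of tapes is right, under which the matching is
  established.\<close>

lemma simulation_run_sum:
  assumes fin: "\<And>c. finite {c'. R c c'}" and fin': "\<And>c. finite {c'. R' c c'}"
    and inj: "inj f"
    and sim: "\<And>c d. I c \<Longrightarrow> R' (f c) d \<longleftrightarrow> (\<exists>c'. R c c' \<and> d = f c')"
    and inv: "\<And>c c'. I c \<Longrightarrow> R c c' \<Longrightarrow> I c'"
  shows "run_bound R c k \<Longrightarrow> I c \<Longrightarrow> run_sum R' \<phi> (f c) = run_sum R (\<lambda>c. \<phi> (f c)) c"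
proof (induction k arbitrary: c)
  case (Suc k)
  note bd' = simulation_run_bound[where R' = R' and f = f and I = I, OF sim inv Suc.prems]
  have halts: "halts R' (f c) \<longleftrightarrow> halts R c" using Suc.prems by (auto simp: halts_def sim)
  have S: "{d. R' (f c) d} = f ` {c'. R c c'}" using Suc.prems by (auto simp: sim)
  show ?case
  proof (cases "halts R c")
    case True
    then show ?thesis using halts by (simp add: run_sum_halted)
  next
    case False
    have "run_sum R' \<phi> (f c) = (\<Sum>c' | R c c'. run_sum R' \<phi> (f c'))"
      using run_sum_step[OF fin' bd'] False halts
      by (simp add: S sum.reindex[OF inj_on_subset[OF inj subset_UNIV]])
    also have "\<dots> = (\<Sum>c' | R c c'. run_sum R (\<lambda>c. \<phi> (f c)) c')"
      using Suc by (intro sum.cong refl) (auto simp: run_bound_Suc inv)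
    also have "\<dots> = run_sum R (\<lambda>c. \<phi> (f c)) c"
      using run_sum_step[OF fin Suc.prems(1) False] by simp
    finally show ?thesis .
  qed
qed (simp add: run_bound_0)

section \<open>Turing machines and tapes\<close>

lemma halted_iff_halts: "halted M c \<longleftrightarrow> halts (ntm_step M) c"
  by (simp add: halted_def halts_def)

lemma paths_eq_runs: "paths M x = runs (ntm_step M) (init_config M x)"
  by (auto simp: paths_def runs_def computation_def halted_iff_halts)

lemma poly_time_iff_run_bound:
  "poly_time M \<longleftrightarrow> (\<exists>p. \<forall>x. run_bound (ntm_step M) (init_config M x) (poly p (length x)))"
  by (simp add: poly_time_def run_bound_def computation_def)

lemma finite_successors:
  assumes "finite (table M)"
  shows "finite {c'. ntm_step M c c'}"
proof (rule finite_subset)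
  show "{c'. ntm_step M c c'} \<subseteq>
      (\<lambda>(q, rs, q', as). (q', map2 tape_act as (snd c))) ` table M"
    by (force simp: ntm_step_def)
qed (use assms in simp)

definition bit_tape :: "bool list \<Rightarrow> int \<Rightarrow> tape" where
  "bit_tape z p = (fst (input_tape z), p)"

definition shift_tape :: "int \<Rightarrow> tape \<Rightarrow> tape" where
  "shift_tape k t = (\<lambda>i. fst t (i + k), snd t - k)"

text \<open>The clock input is written from right to left, so it need not be rewound: being a string of
  equal bits, it is the input tape of the clock up to a shift.\<close>

definition pad_tape :: "nat \<Rightarrow> tape" where
  "pad_tape j = (\<lambda>i. if - int j < i \<and> i \<le> 0 then Bit False else Blank, - int j)"

lemma tape_read_bit_tape:
  "tape_read (bit_tape z p) = (if 0 \<le> p \<and> p < int (length z) then Bit (z ! nat p) else Blank)"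
  by (simp add: tape_read_def bit_tape_def input_tape_def)

lemma tape_read_bit_tape_end [simp]: "tape_read (bit_tape z (int (length z))) = Blank"
  by (simp add: tape_read_bit_tape)

lemma tape_read_blank_tape [simp]: "tape_read blank_tape = Blank"
  by (simp add: tape_read_def blank_tape_def)

lemma tape_read_pad_tape [simp]: "tape_read (pad_tape j) = Blank"
  by (simp add: tape_read_def pad_tape_def)

lemma tape_read_shift_tape [simp]: "tape_read (shift_tape k t) = tape_read t"
  by (simp add: tape_read_def shift_tape_def)

text \<open>A machine sees only the cell under its head, so displacing a tape commutes with every
  action and leaves the run otherwise unchanged.\<close>

lemma tape_act_shift_tape [simp]: "tape_act a (shift_tape k t) = shift_tape k (tape_act a t)"
  by (auto simp: tape_act_def shift_tape_def fun_eq_iff)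

lemma bit_tape_Nil: "bit_tape [] 0 = blank_tape"
  by (auto simp: bit_tape_def blank_tape_def input_tape_def)

lemma bit_tape_0: "bit_tape z 0 = input_tape z"
  by (simp add: bit_tape_def input_tape_def)

lemma tape_act_write_same:
  "s = tape_read t \<Longrightarrow> tape_act (s, m) t = (fst t, snd t + head_shift m)"
  by (simp add: tape_act_def tape_read_def)

lemma tape_act_stay [simp]: "s = tape_read t \<Longrightarrow> tape_act (s, Stay) t = t"
  by (simp add: tape_act_write_same)

lemma tape_act_bit_tape_same:
  "s = tape_read (bit_tape z p) \<Longrightarrow> tape_act (s, m) (bit_tape z p) = bit_tape z (p + head_shift m)"
  by (simp add: bit_tape_def tape_act_write_same)

lemma tape_act_append [simp]:
  "tape_act (Bit b, MoveRight) (bit_tape z (int (length z))) =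
     bit_tape (z @ [b]) (int (length (z @ [b])))"
  by (auto simp: tape_act_def bit_tape_def input_tape_def fun_eq_iff nth_append)

lemma tape_act_erase_last:
  "tape_act (Blank, MoveLeft) (bit_tape (z @ [b]) (int (length z))) =
     bit_tape z (int (length z) - 1)"
  by (auto simp: tape_act_def bit_tape_def input_tape_def fun_eq_iff nth_append)

lemma tape_act_pad [simp]:
  "tape_act (Bit False, MoveLeft) (pad_tape j) = pad_tape (Suc j)"
  by (auto simp: tape_act_def pad_tape_def fun_eq_iff)

text \<open>The leftmost of the \<open>j\<close> zeros is in cell 1 - j, and the head moves onto it
  from the blank on its left. For j = 0 the tape is blank and the shift is -1.\<close>

lemma tape_act_pad_start:
  "tape_act (Blank, MoveRight) (pad_tape j) = shift_tape (int j - 1) (input_tape (unary j))"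
  by (auto simp: tape_act_def pad_tape_def shift_tape_def input_tape_def unary_def fun_eq_iff)

lemma map2_tape_act_keep [simp]: "map2 tape_act (map ((\<lambda>s. (s, Stay)) \<circ> tape_read) ts) ts = ts"
  by (induction ts) auto

lemma map2_tape_act_blanks [simp]:
  "map2 tape_act (replicate n (Blank, Stay)) (replicate n blank_tape) = replicate n blank_tape"
  by (induction n) auto

lemma outputs_bit_tape:
  assumes "snd c ! 1 = bit_tape z p"
  shows "outputs c y \<longleftrightarrow> y = z"
proof
  assume "outputs c y"
  then have o: "i < length y \<Longrightarrow> fst (input_tape z) (int i) = Bit (y ! i)"
      "fst (input_tape z) (int (length y)) \<notin> range Bit" for i
    using assms by (auto simp: outputs_def bit_tape_def)
  have "length z \<le> length y" using o(2) by (auto simp: input_tape_def split: if_splits)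
  moreover have "length y \<le> length z"
    using o(1)[of "length z"] by (cases "length z < length y") (auto simp: input_tape_def)
  ultimately show "y = z"
    using o(1) by (intro nth_equalityI) (auto simp: input_tape_def split: if_splits)
qed (auto simp: outputs_def assms[simplified] bit_tape_def input_tape_def)

lemma sum_words_Suc:
  fixes f :: "bool list \<Rightarrow> 'a :: comm_monoid_add"
  shows "(\<Sum>y | length y = Suc k \<and> set y \<subseteq> G. f y) =
    (\<Sum>b \<in> G. \<Sum>y | length y = k \<and> set y \<subseteq> G. f (b # y))"
proof -
  have "{y. length y = Suc k \<and> set y \<subseteq> G} =
      (\<lambda>(b, y). b # y) ` (G \<times> {y. length y = k \<and> set y \<subseteq> G})" (is "?L = ?R")
  proof (intro equalityI subsetI)
    fix y assume "y \<in> ?L"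
    then show "y \<in> ?R" by (cases y) auto
  qed auto
  then have "sum f {y. length y = Suc k \<and> set y \<subseteq> G} =
      (\<Sum>(b, y) \<in> G \<times> {y. length y = k \<and> set y \<subseteq> G}. f (b # y))"
    by (simp add: sum.reindex inj_on_def case_prod_unfold)
  then show ?thesis by (simp add: sum.cartesian_product)
qed

section \<open>The guessing machine\<close>

text \<open>\<open>Start\<close> skips \<open>0\<^sup>r1\<close> and \<open>Copy\<close> copies \<open>w\<close> to the working tape; meanwhile, and in the states \<open>Pad j\<close>, the
  clock receives one zero per step. In the states \<open>Clock q\<close> the clock runs and each of its steps
  appends a guessed bit to the working tape. \<open>Erase\<close> deletes a guessed number of bits at the end of
  the working tape, \<open>Rewind\<close> moves its head back, and \<open>Sim q\<close> runs the machine for \<open>A\<close>.\<close>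

datatype phase = Start | Copy | Pad nat | Clock nat | Erase | Rewind | Sim nat

text \<open>The complexity classes use machines whose states are natural numbers, so phases are
  coded by the injection \<open>to_nat\<close>.\<close>

instance phase :: countable by countable_datatype

abbreviation keep :: "symbol list \<Rightarrow> (symbol \<times> move) list" where
  "keep rs \<equiv> map (\<lambda>s. (s, Stay)) rs"

type_synonym rule = "phase \<times> symbol \<times> symbol \<times> symbol list \<times> symbol list \<times>
  phase \<times> (symbol \<times> move) \<times> (symbol \<times> move) \<times> (symbol \<times> move) list \<times> (symbol \<times> move) list"

text \<open>\<open>C\<close> is the clock and \<open>G\<close> the set of bits that may be guessed. The phases after \<open>Clock\<close> exist only if
  \<open>True \<in> G\<close>: for \<open>G = {False}\<close> the machine is deterministic and halts with the clock, having
  printed a one followed by as many zeros as the clock made steps.\<close>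

locale prefix_guesser =
  fixes C M :: "nat ntm" and pad :: nat and G :: "bool set"
  assumes wf_C: "wf_ntm C" and wf_M: "wf_ntm M" and det_C: "deterministic C"
    and G_nonempty: "G \<noteq> {}"
begin

text \<open>After the clock has halted, its tapes are left alone, but each rule must still name what
  is read on them. For a finite table, the possible readings are restricted to blanks, the input
  symbol of the clock and the symbols it can write.\<close>

definition clock_symbols :: "symbol set" where
  "clock_symbols = {Blank, Bit False} \<union> (\<Union>(q, rs, q', as) \<in> table C. fst ` set as)"

definition clock_reads :: "symbol list set" where
  "clock_reads = {rs. set rs \<subseteq> clock_symbols \<and> length rs = tape_count C}"

definition clock_states :: "nat set" where
  "clock_states = insert (start_state C) ((\<lambda>(q, rs, q', as). q') ` table C)"

abbreviation m_blanks :: "symbol list" where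
  "m_blanks \<equiv> replicate (tape_count M - 1) Blank"

abbreviation c_blanks :: "symbol list" where
  "c_blanks \<equiv> replicate (tape_count C - 1) Blank"

text \<open>\<open>erase_bit\<close> and \<open>erase_stop\<close> apply to the same readings: this
  choice is the guess of the prefix length, and the ones printed by \<open>erase_bit\<close> record
  it in the output. The one printed by \<open>pad_end\<close> becomes the leading digit of the
  numeral when only zeros are guessed.\<close>

inductive rule :: "phase \<Rightarrow> symbol \<Rightarrow> symbol \<Rightarrow> symbol list \<Rightarrow> symbol list \<Rightarrow>
  phase \<Rightarrow> symbol \<times> move \<Rightarrow> symbol \<times> move \<Rightarrow> (symbol \<times> move) list \<Rightarrow> (symbol \<times> move) list \<Rightarrow> bool" where
  start_zero: "rule Start (Bit False) Blank (Blank # m_blanks) (Blank # c_blanks)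
      Start (Bit False, MoveRight) (Blank, Stay) (keep (Blank # m_blanks))
          ((Bit False, MoveLeft) # keep c_blanks)"
| start_one: "rule Start (Bit True) Blank (Blank # m_blanks) (Blank # c_blanks)
      Copy (Bit True, MoveRight) (Blank, Stay) (keep (Blank # m_blanks))
          ((Bit False, MoveLeft) # keep c_blanks)"
| start_end: "rule Start Blank Blank (Blank # m_blanks) (Blank # c_blanks)
      (Pad 0) (Blank, Stay) (Blank, Stay) (keep (Blank # m_blanks)) (keep (Blank # c_blanks))"
| copy_bit: "rule Copy (Bit b) Blank (Blank # m_blanks) (Blank # c_blanks)
      Copy (Bit b, MoveRight) (Blank, Stay) ((Bit b, MoveRight) # keep m_blanks)
          ((Bit False, MoveLeft) # keep c_blanks)"
| copy_end: "rule Copy Blank Blank (Blank # m_blanks) (Blank # c_blanks)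
      (Pad 0) (Blank, Stay) (Blank, Stay) (keep (Blank # m_blanks)) (keep (Blank # c_blanks))"
| pad_one: "j < pad \<Longrightarrow> rule (Pad j) Blank Blank (Blank # m_blanks) (Blank # c_blanks)
      (Pad (Suc j)) (Blank, Stay) (Blank, Stay) (keep (Blank # m_blanks))
          ((Bit False, MoveLeft) # keep c_blanks)"
| pad_end: "rule (Pad pad) Blank Blank (Blank # m_blanks) (Blank # c_blanks)
      (Clock (start_state C)) (Blank, Stay) (Bit True, MoveRight) (keep (Blank # m_blanks))
          ((Blank, MoveRight) # keep c_blanks)"
| clock_step: "(q, rs, q', as) \<in> table C \<Longrightarrow> b \<in> G \<Longrightarrow> rule (Clock q) Blank Blank (Blank # m_blanks) rs
      (Clock q') (Blank, Stay) (Bit b, MoveRight) ((Bit b, MoveRight) # keep m_blanks) as"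
| clock_halt: "True \<in> G \<Longrightarrow> q \<in> clock_states \<Longrightarrow> rs \<in> clock_reads \<Longrightarrow> \<forall>q' as. (q, rs, q', as) \<notin> table C \<Longrightarrow>
    rule (Clock q) Blank Blank (Blank # m_blanks) rs
      Erase (Blank, Stay) (Blank, Stay) ((Blank, MoveLeft) # keep m_blanks) (keep rs)"
| erase_bit: "True \<in> G \<Longrightarrow> rs \<in> clock_reads \<Longrightarrow> rule Erase Blank Blank (Bit b # m_blanks) rs
      Erase (Blank, Stay) (Bit True, MoveRight) ((Blank, MoveLeft) # keep m_blanks) (keep rs)"
| erase_stop: "True \<in> G \<Longrightarrow> rs \<in> clock_reads \<Longrightarrow> rule Erase Blank Blank (Bit b # m_blanks) rs
      Rewind (Blank, Stay) (Blank, Stay) (keep (Bit b # m_blanks)) (keep rs)"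
| erase_end: "True \<in> G \<Longrightarrow> rs \<in> clock_reads \<Longrightarrow> rule Erase Blank Blank (Blank # m_blanks) rs
      Rewind (Blank, Stay) (Blank, Stay) (keep (Blank # m_blanks)) (keep rs)"
| rewind_bit: "True \<in> G \<Longrightarrow> rs \<in> clock_reads \<Longrightarrow> rule Rewind Blank Blank (Bit b # m_blanks) rs
      Rewind (Blank, Stay) (Blank, Stay) ((Bit b, MoveLeft) # keep m_blanks) (keep rs)"
| rewind_end: "True \<in> G \<Longrightarrow> rs \<in> clock_reads \<Longrightarrow> rule Rewind Blank Blank (Blank # m_blanks) rs
      (Sim (start_state M)) (Blank, Stay) (Blank, Stay) ((Blank, MoveRight) # keep m_blanks) (keep rs)"
| sim_step: "True \<in> G \<Longrightarrow> rs \<in> clock_reads \<Longrightarrow> (q, rs', q', as) \<in> table M \<Longrightarrow> rule (Sim q) Blank Blank rs' rs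
      (Sim q') (Blank, Stay) (Blank, Stay) as (keep rs)"

inductive_simps rule_simps [simp]:
  "rule Start a b rs rs' q' \<alpha> \<beta> as as'"
  "rule Copy a b rs rs' q' \<alpha> \<beta> as as'"
  "rule (Pad j) a b rs rs' q' \<alpha> \<beta> as as'"
  "rule (Clock q) a b rs rs' q' \<alpha> \<beta> as as'"
  "rule Erase a b rs rs' q' \<alpha> \<beta> as as'"
  "rule Rewind a b rs rs' q' \<alpha> \<beta> as as'"
  "rule (Sim q) a b rs rs' q' \<alpha> \<beta> as as'"

definition rules :: "rule set" where
  "rules = {(q, a, b, rs, rs', q', \<alpha>, \<beta>, as, as'). rule q a b rs rs' q' \<alpha> \<beta> as as'}"

text \<open>The tapes are the input, the output, the tapes of \<open>M\<close> (starting with the working tape) and those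
  of the clock.\<close>

definition entry :: "rule \<Rightarrow> nat \<times> symbol list \<times> nat \<times> (symbol \<times> move) list" where
  "entry = (\<lambda>(q, a, b, rs, rs', q', \<alpha>, \<beta>, as, as').
     (to_nat q, a # b # rs @ rs', to_nat q', \<alpha> # \<beta> # as @ as'))"

definition machine :: "nat ntm" where
  "machine = \<lparr>tape_count = Suc (Suc (tape_count M + tape_count C)), start_state = to_nat Start,
     accept_states = (\<lambda>q. to_nat (Sim q)) ` accept_states M, table = entry ` rules\<rparr>"

definition conf :: "phase \<Rightarrow> tape \<Rightarrow> tape \<Rightarrow> tape list \<Rightarrow> tape list \<Rightarrow> nat config" where
  "conf q ti to ts us = (to_nat q, ti # to # ts @ us)"

lemma tape_count_M: "tape_count M = Suc (tape_count M - 1)" "Suc (tape_count M - Suc 0) = tape_count M"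
  using wf_M by (auto simp: wf_ntm_def)

lemma tape_count_C: "tape_count C = Suc (tape_count C - 1)" "Suc (tape_count C - Suc 0) = tape_count C"
  using wf_C by (auto simp: wf_ntm_def)

lemma table_C_length:
  "(q, rs, q', as) \<in> table C \<Longrightarrow> length rs = tape_count C \<and> length as = tape_count C"
  using wf_C by (auto simp: wf_ntm_def)

lemma table_M_length:
  "(q, rs, q', as) \<in> table M \<Longrightarrow> length rs = tape_count M \<and> length as = tape_count M"
  using wf_M by (auto simp: wf_ntm_def)

lemma rules_length:
  assumes "(q, a, b, rs, rs', q', \<alpha>, \<beta>, as, as') \<in> rules"
  shows "length rs = tape_count M \<and> length as = tape_count M \<and>
    length rs' = tape_count C \<and> length as' = tape_count C"
  using assms unfolding rules_def mem_Collect_eq prod.case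
  by cases (auto simp: tape_count_M(2) tape_count_C(2) clock_reads_def dest: table_C_length
      table_M_length)

text \<open>An entry lists the readings of all tapes in one word. Since the blocks for
  \<open>M\<close> and for the clock have fixed lengths, the word splits back into blocks in only
  one way.\<close>

lemma step_iff:
  assumes "length ts = tape_count M" and "length us = tape_count C"
  shows "ntm_step machine (conf q ti to ts us) d \<longleftrightarrow>
    (\<exists>q' \<alpha> \<beta> as as'.
       (q, tape_read ti, tape_read to, map tape_read ts, map tape_read us, q', \<alpha>, \<beta>, as, as') \<in> rules \<and>
       d = conf q' (tape_act \<alpha> ti) (tape_act \<beta> to) (map2 tape_act as ts) (map2 tape_act as' us))"
    (is "?L \<longleftrightarrow> ?R")
proof
  assume ?L
  then obtain q' as0 where "(to_nat q, tape_read ti # tape_read to # map tape_read ts @ map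
      tape_read us, q', as0) \<in> entry ` rules"
    and d: "d = (q', map2 tape_act as0 (ti # to # ts @ us))"
    by (auto simp: ntm_step_def machine_def conf_def)
  then obtain p a b rs rs' p' \<alpha> \<beta> as as' where r: "(p, a, b, rs, rs', p', \<alpha>, \<beta>, as, as') \<in> rules"
    and e: "to_nat q = to_nat p" "tape_read ti = a" "tape_read to = b"
      "map tape_read ts @ map tape_read us = rs @ rs'" "q' = to_nat p'" "as0 = \<alpha> # \<beta> # as @ as'"
    by (auto simp: entry_def)
  note l = rules_length[OF r]
  have "map tape_read ts = rs" "map tape_read us = rs'" using e(4) l assms by auto
  then show ?R
    using r e d l assms by (intro exI[of _ p'] exI[of _ \<alpha>] exI[of _ \<beta>] exI[of _ as] exI[of _ as'])
        (simp add: conf_def)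
next
  assume ?R
  then obtain q' \<alpha> \<beta> as as' where r:
      "(q, tape_read ti, tape_read to, map tape_read ts, map tape_read us, q', \<alpha>, \<beta>, as, as') \<in> rules"
    and d: "d = conf q' (tape_act \<alpha> ti) (tape_act \<beta> to) (map2 tape_act as ts) (map2 tape_act as' us)"
    by blast
  show ?L
    unfolding ntm_step_def
  proof (intro exI conjI)
    show "(fst (conf q ti to ts us), map tape_read (snd
        (conf q ti to ts us)), to_nat q', \<alpha> # \<beta> # as @ as')
        \<in> table machine"
      using r by (force simp: machine_def conf_def entry_def image_iff)
    show "d = (to_nat q', map2 tape_act (\<alpha> # \<beta> # as @ as') (snd (conf q ti to ts us)))"
      using d rules_length[OF r] assms by (simp add: conf_def)
  qed
qed

lemma finite_clock_reads: "finite clock_reads"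
proof -
  have "finite clock_symbols" using wf_C by (auto simp: clock_symbols_def wf_ntm_def)
  then show ?thesis unfolding clock_reads_def by (rule finite_lists_length_eq)
qed

lemma finite_rules: "finite rules"
proof (rule finite_subset)
  let ?m = "m_blanks" and ?c = "c_blanks" and ?S = "(Blank, Stay)"
  \<comment> \<open>The clauses of \<open>rule\<close>, some without their side conditions, written
    as unions over finite index sets: bits, numbers below \<open>pad\<close>, table entries, clock
    states and clock readings.\<close>
  let ?X = "{(Start, Bit False, Blank, Blank # ?m, Blank # ?c,
      Start, (Bit False, MoveRight), ?S, keep (Blank # ?m), (Bit False, MoveLeft) # keep ?c),
     (Start, Bit True, Blank, Blank # ?m, Blank # ?c,
      Copy, (Bit True, MoveRight), ?S, keep (Blank # ?m), (Bit False, MoveLeft) # keep ?c),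
     (Start, Blank, Blank, Blank # ?m, Blank # ?c,
      Pad 0, ?S, ?S, keep (Blank # ?m), keep (Blank # ?c)),
     (Copy, Blank, Blank, Blank # ?m, Blank # ?c,
      Pad 0, ?S, ?S, keep (Blank # ?m), keep (Blank # ?c)),
     (Pad pad, Blank, Blank, Blank # ?m, Blank # ?c,
      Clock (start_state C), ?S, (Bit True, MoveRight), keep (Blank # ?m),
          (Blank, MoveRight) # keep ?c)} \<union>
    (\<Union>b.
      {(Copy, Bit b, Blank, Blank # ?m, Blank # ?c,
      Copy, (Bit b, MoveRight), ?S, (Bit b, MoveRight) # keep ?m, (Bit False, MoveLeft) # keep ?c)}) \<union>
    (\<Union>j \<in> {..<pad}.
      {(Pad j, Blank, Blank, Blank # ?m, Blank # ?c,
      Pad (Suc j), ?S, ?S, keep (Blank # ?m), (Bit False, MoveLeft) # keep ?c)}) \<union>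
    (\<Union>b. \<Union>(q, rs, q', as) \<in> table C.
      {(Clock q, Blank, Blank, Blank # ?m, rs,
      Clock q', ?S, (Bit b, MoveRight), (Bit b, MoveRight) # keep ?m, as)}) \<union>
    (\<Union>q \<in> clock_states. \<Union>rs \<in> clock_reads.
      {(Clock q, Blank, Blank, Blank # ?m, rs,
      Erase, ?S, ?S, (Blank, MoveLeft) # keep ?m, keep rs)}) \<union>
    (\<Union>b. \<Union>rs \<in> clock_reads.
      {(Erase, Blank, Blank, Bit b # ?m, rs,
      Erase, ?S, (Bit True, MoveRight), (Blank, MoveLeft) # keep ?m, keep rs)}) \<union>
    (\<Union>b. \<Union>rs \<in> clock_reads.
      {(Erase, Blank, Blank, Bit b # ?m, rs,
      Rewind, ?S, ?S, keep (Bit b # ?m), keep rs)}) \<union>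
    (\<Union>rs \<in> clock_reads.
      {(Erase, Blank, Blank, Blank # ?m, rs,
      Rewind, ?S, ?S, keep (Blank # ?m), keep rs)}) \<union>
    (\<Union>b. \<Union>rs \<in> clock_reads.
      {(Rewind, Blank, Blank, Bit b # ?m, rs,
      Rewind, ?S, ?S, (Bit b, MoveLeft) # keep ?m, keep rs)}) \<union>
    (\<Union>rs \<in> clock_reads.
      {(Rewind, Blank, Blank, Blank # ?m, rs,
      Sim (start_state M), ?S, ?S, (Blank, MoveRight) # keep ?m, keep rs)}) \<union>
    (\<Union>rs \<in> clock_reads. \<Union>(q, rs', q', as) \<in> table M.
      {(Sim q, Blank, Blank, rs', rs,
      Sim q', ?S, ?S, as, keep rs)})"
  show "rules \<subseteq> ?X"
  proof
    fix r assume "r \<in> rules"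
    then obtain q a b rs rs' q' \<alpha> \<beta> as as' where r: "r = (q, a, b, rs, rs', q', \<alpha>, \<beta>, as, as')"
      and R: "rule q a b rs rs' q' \<alpha> \<beta> as as'"
      by (auto simp: rules_def)
    from R show "r \<in> ?X" unfolding r by cases (auto simp del: rule_simps, (drule (1) bspec)+, simp)
  qed
  show "finite ?X"
    using wf_C wf_M finite_clock_reads by (simp add: wf_ntm_def clock_states_def case_prod_unfold)
qed

lemma wf_machine: "wf_ntm machine"
  unfolding wf_ntm_def
proof (intro conjI)
  show "finite (table machine)" by (simp add: machine_def finite_rules)
  show "\<forall>(q, rs, q', as) \<in> table machine. length rs = tape_count machine \<and> length as =
      tape_count machine"
    by (auto simp: machine_def entry_def dest: rules_length)
qed (simp add: machine_def)

lemma finite_branching: "finite {d. ntm_step machine e d}"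
  using finite_successors[of machine e] wf_machine by (simp add: wf_ntm_def)

end

section \<open>The phases of the computation\<close>

text \<open>Only the input tape of the clock is displaced, because its zeros were written leftwards
  from cell 0.\<close>

definition shift_first :: "int \<Rightarrow> tape list \<Rightarrow> tape list" where
  "shift_first s ts = (case ts of [] \<Rightarrow> [] | t # ts' \<Rightarrow> shift_tape s t # ts')"

lemma length_shift_first [simp]: "length (shift_first s ts) = length ts"
  by (simp add: shift_first_def split: list.split)

lemma map_tape_read_shift_first [simp]: "map tape_read (shift_first s ts) = map tape_read ts"
  by (simp add: shift_first_def split: list.split)

lemma map2_tape_act_shift_first [simp]:
  "map2 tape_act as (shift_first s ts) = shift_first s (map2 tape_act as ts)"
  by (cases as) (auto simp: shift_first_def split: list.split)

text \<open>Decodes the word from a pair, but is total: on a string without a one it is empty, in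
  agreement with the rule \<open>start_end\<close>.\<close>

definition payload :: "bool list \<Rightarrow> bool list" where
  "payload v = tl (dropWhile Not v)"

section \<open>Set-up and clock phases of the guessing machine\<close>

context prefix_guesser
begin

abbreviation m_tapes :: "bool list \<Rightarrow> int \<Rightarrow> tape list" where
  "m_tapes x p \<equiv> bit_tape x p # replicate (tape_count M - 1) blank_tape"

abbreviation unfold :: "nat config \<Rightarrow> nat \<Rightarrow> nat config multiset \<Rightarrow> bool" where
  "unfold \<equiv> unfolds (ntm_step machine)"

definition setup_conf :: "phase \<Rightarrow> bool list \<Rightarrow> nat \<Rightarrow> bool list \<Rightarrow> nat \<Rightarrow> nat config" where
  "setup_conf q v i x j = conf q (bit_tape v (int i)) blank_tape
     (m_tapes x (int (length x))) (pad_tape j # replicate (tape_count C - 1) blank_tape)"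

lemma setup_step:
  "ntm_step machine (setup_conf q v i x j) d \<longleftrightarrow>
    (\<exists>q' \<alpha> \<beta> as as'.
       rule q (tape_read (bit_tape v (int i))) Blank (Blank # m_blanks)
           (Blank # c_blanks) q' \<alpha> \<beta> as as' \<and>
       d = conf q' (tape_act \<alpha> (bit_tape v (int i))) (tape_act \<beta> blank_tape)
         (map2 tape_act as (m_tapes x (int (length x))))
         (map2 tape_act as' (pad_tape j # replicate (tape_count C - 1) blank_tape)))"
  unfolding setup_conf_def
  by (subst step_iff) (simp_all add: tape_count_M(2) tape_count_C(2) rules_def)

lemmas unfold_one = unfolds_one[where R = "ntm_step machine"]

lemma setup_steps:
  "i < length v \<Longrightarrow> \<not> v ! i \<Longrightarrow>
    ntm_step machine (setup_conf Start v i x j) d \<longleftrightarrow> d = setup_conf Start v (Suc i) x (Suc j)"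
  "i < length v \<Longrightarrow> v ! i \<Longrightarrow>
    ntm_step machine (setup_conf Start v i x j) d \<longleftrightarrow> d = setup_conf Copy v (Suc i) x (Suc j)"
  "i = length v \<Longrightarrow>
    ntm_step machine (setup_conf Start v i x j) d \<longleftrightarrow> d = setup_conf (Pad 0) v i x j"
  "i < length v \<Longrightarrow>
    ntm_step machine (setup_conf Copy v i x j) d \<longleftrightarrow> d = setup_conf Copy v (Suc i) (x @ [v ! i]) (Suc j)"
  "i = length v \<Longrightarrow>
    ntm_step machine (setup_conf Copy v i x j) d \<longleftrightarrow> d = setup_conf (Pad 0) v i x j"
  "i = length v \<Longrightarrow> k < pad \<Longrightarrow>
    ntm_step machine (setup_conf (Pad k) v i x j) d \<longleftrightarrow> d = setup_conf (Pad (Suc k)) v i x (Suc j)"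
  unfolding setup_step
  by (auto simp: setup_conf_def tape_act_bit_tape_same tape_read_bit_tape add.commute simp del:
      split_paired_Ex)

definition clock_conf :: "bool list \<Rightarrow> int \<Rightarrow> bool list \<Rightarrow> bool list \<Rightarrow> nat config \<Rightarrow> nat config" where
  "clock_conf v s x o' e = conf (Clock (fst e)) (bit_tape v (int (length v)))
     (bit_tape o' (int (length o'))) (m_tapes x (int (length x))) (shift_first s (snd e))"

lemma pad_end_step:
  "ntm_step machine (setup_conf (Pad pad) v (length v) x j) d \<longleftrightarrow>
     d = clock_conf v (int j - 1) x [True] (init_config C (unary j))"
  unfolding setup_step
  using tape_act_append[of True "[]"]
  by (auto simp: clock_conf_def tape_act_bit_tape_same tape_act_pad_start init_config_def
      shift_first_def bit_tape_Nil simp del: split_paired_Ex)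

lemma unfold_pad:
  "k \<le> pad \<Longrightarrow> unfold (clock_conf v (int (j + pad - k) - 1) x [True] (init_config C (unary
      (j + pad - k)))) t F \<Longrightarrow>
    unfold (setup_conf (Pad k) v (length v) x j) (Suc (pad - k + t)) F"
proof (induction "pad - k" arbitrary: k j)
  case 0
  then have k: "k = pad" by simp
  show ?case using unfold_one[OF pad_end_step] "0.prems" unfolding k by simp
next
  case (Suc n)
  have "unfold (setup_conf (Pad (Suc k)) v (length v) x (Suc j)) (Suc (pad - Suc k + t)) F"
    using Suc.prems Suc.hyps(2) by (intro Suc.hyps(1)) (auto simp: Suc_diff_Suc algebra_simps)
  from unfold_one[OF setup_steps(6) this] Suc.hyps(2) show ?case
    by (simp add: Suc_diff_Suc)
qed

lemma unfold_copy:
  "length u = i \<Longrightarrow> unfold (setup_conf (Pad 0) (u @ v) (i + length v) (x @ v) (j + length v)) t F \<Longrightarrow>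
    unfold (setup_conf Copy (u @ v) i x j) (Suc (length v + t)) F"
proof (induction v arbitrary: u i x j)
  case Nil
  then show ?case by (auto intro!: unfold_one[OF setup_steps(5)])
next
  case (Cons b v)
  have "unfold (setup_conf Copy ((u @ [b]) @ v) (Suc i) (x @ [b]) (Suc j)) (Suc (length v + t)) F"
    using Cons.prems by (intro Cons.IH) auto
  note IH = this
  have "unfold (setup_conf Copy (u @ b # v) i x j) (Suc (Suc (length v + t))) F"
    by (rule unfold_one[OF setup_steps(4)]) (use IH Cons.prems in \<open>auto simp: nth_append\<close>)
  then show ?case by simp
qed

lemma unfold_start:
  "length u = i \<Longrightarrow> unfold (setup_conf (Pad 0) (u @ v) (i + length v) (payload v) (j + length v)) t F \<Longrightarrow>
    unfold (setup_conf Start (u @ v) i [] j) (Suc (length v + t)) F"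
proof (induction v arbitrary: u i j)
  case Nil
  then show ?case by (auto intro!: unfold_one[OF setup_steps(3)] simp: payload_def)
next
  case (Cons b v)
  show ?case
  proof (cases b)
    case True
    have "unfold (setup_conf Copy ((u @ [b]) @ v) (Suc i) [] (Suc j)) (Suc (length v + t)) F"
      using Cons.prems True by (intro unfold_copy) (auto simp: payload_def)
    note IH = this
  have "unfold (setup_conf Start (u @ b # v) i [] j) (Suc (Suc (length v + t))) F"
      by (rule unfold_one[OF setup_steps(2)]) (use IH Cons.prems True in \<open>auto simp: nth_append\<close>)
    then show ?thesis by simp
  next
    case False
    have "unfold (setup_conf Start ((u @ [b]) @ v) (Suc i) [] (Suc j)) (Suc (length v + t)) F"
      using Cons.prems False by (intro Cons.IH) (auto simp: payload_def)
    note IH = this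
  have "unfold (setup_conf Start (u @ b # v) i [] j) (Suc (Suc (length v + t))) F"
      by (rule unfold_one[OF setup_steps(1)]) (use IH Cons.prems False in \<open>auto simp: nth_append\<close>)
    then show ?thesis by simp
  qed
qed

lemma init_config_machine: "init_config machine v = setup_conf Start v 0 [] 0"
proof -
  have p: "pad_tape 0 = blank_tape" by (auto simp: pad_tape_def blank_tape_def)
  have r: "replicate k blank_tape = blank_tape # replicate (k - 1) blank_tape" if "k = Suc l" for k l
    using that by simp
  show ?thesis
    by (simp add: init_config_def machine_def setup_conf_def conf_def p bit_tape_0
        bit_tape_Nil[unfolded bit_tape_0]
        replicate_add r[OF tape_count_M(1)] r[OF tape_count_C(1)])
qed

text \<open>Each input symbol and each unit of \<open>pad\<close> costs one step and contributes one
  zero to the clock input. The two further steps are the entries into \<open>Pad\<close> and into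
  \<open>Clock\<close>.\<close>

lemma unfold_setup:
  assumes "unfold (clock_conf v (int (length v + pad) - 1) (payload v) [True] (init_config C (unary
      (length v + pad)))) t F"
  shows "unfold (init_config machine v) (length v + pad + 2 + t) F"
proof -
  have "unfold (setup_conf (Pad 0) v (length v) (payload v) (length v)) (Suc (pad + t)) F"
    using unfold_pad[of 0 v "length v" "payload v" t F] assms by simp
  then have "unfold (setup_conf Start ([] @ v) 0 [] 0) (Suc (length v + Suc (pad + t))) F"
    by (intro unfold_start) auto
  then show ?thesis by (simp add: init_config_machine algebra_simps)
qed

text \<open>An invariant of the clock which ensures that, once it halts, its state and readings
  belong to the finite sets for which \<open>clock_halt\<close> and the later rules exist.\<close>

definition clock_ok :: "nat config \<Rightarrow> bool" where
  "clock_ok e \<longleftrightarrow> fst e \<in> clock_states \<and> length (snd e) = tape_count C \<and>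
     (\<forall>t \<in> set (snd e). range (fst t) \<subseteq> clock_symbols)"

lemma clock_ok_init: "clock_ok (init_config C (unary n))"
  by (auto simp: clock_ok_def init_config_def clock_states_def tape_count_C(2) input_tape_def
      blank_tape_def clock_symbols_def unary_def split: if_splits)

lemma clock_ok_step:
  assumes "clock_ok e" and "ntm_step C e e'"
  shows "clock_ok e'"
proof -
  obtain q' as where r: "(fst e, map tape_read (snd e), q', as) \<in> table C"
    and e': "e' = (q', map2 tape_act as (snd e))"
    using assms(2) by (auto simp: ntm_step_def)
  have q': "q' \<in> clock_states" using r by (force simp: clock_states_def)
  have as: "fst a \<in> clock_symbols" if "a \<in> set as" for a
    using r that by (fastforce simp: clock_symbols_def)
  have "range (fst (tape_act a t)) \<subseteq> clock_symbols" if "a \<in> set as" "t \<in> set (snd e)" for a t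
    using as[OF that(1)] assms(1) that(2) by (auto simp: tape_act_def clock_ok_def)
  then have "\<forall>t \<in> set (map2 tape_act as (snd e)). range (fst t) \<subseteq> clock_symbols"
    by (metis (no_types, lifting) imageE in_set_zipE list.set_map split_beta prod.collapse)
  then show ?thesis
    using assms(1) q' table_C_length[OF r] by (simp add: clock_ok_def e')
qed

lemma clock_ok_reads: "clock_ok e \<Longrightarrow> map tape_read (snd e) \<in> clock_reads"
  by (auto simp: clock_ok_def clock_reads_def tape_read_def)

lemma clock_conf_step_iff:
  assumes "clock_ok e"
  shows "ntm_step machine (clock_conf v s x o' e) d \<longleftrightarrow>
    (\<exists>q' \<alpha> \<beta> as as'.
       rule (Clock (fst e)) Blank Blank (Blank # m_blanks) (map tape_read (snd e)) q' \<alpha> \<beta> as as' \<and>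
       d = conf q' (tape_act \<alpha> (bit_tape v (int (length v)))) (tape_act \<beta> (bit_tape o' (int
           (length o'))))
         (map2 tape_act as (m_tapes x (int (length x)))) (shift_first s (map2 tape_act as' (snd e))))"
  unfolding clock_conf_def using assms
  by (subst step_iff) (simp_all add: tape_count_M(2) clock_ok_def rules_def)

text \<open>Since the clock is deterministic, the guessed bit is the only choice; and
  \<open>clock_halt\<close> is blocked because a table entry applies.\<close>

lemma clock_conf_step:
  assumes ok: "clock_ok e" and st: "ntm_step C e e'"
  shows "ntm_step machine (clock_conf v s x o' e) d \<longleftrightarrow>
    (\<exists>b \<in> G. d = clock_conf v s (x @ [b]) (o' @ [b]) e')"
proof -
  obtain q1 as1 where r: "(fst e, map tape_read (snd e), q1, as1) \<in> table C"
    and e': "e' = (q1, map2 tape_act as1 (snd e))"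
    using st by (auto simp: ntm_step_def)
  have uq: "(fst e, map tape_read (snd e), q2, as2) \<in> table C \<longleftrightarrow> q2 = q1 \<and> as2 = as1" for q2 as2
    using det_C r unfolding deterministic_def by blast
  show ?thesis
  proof
    assume "ntm_step machine (clock_conf v s x o' e) d"
    then show "\<exists>b \<in> G. d = clock_conf v s (x @ [b]) (o' @ [b]) e'"
      unfolding clock_conf_step_iff[OF ok] by (auto simp: uq e' clock_conf_def)
  next
    assume "\<exists>b \<in> G. d = clock_conf v s (x @ [b]) (o' @ [b]) e'"
    then obtain b where b: "b \<in> G" "d = clock_conf v s (x @ [b]) (o' @ [b]) e'" by blast
    have "rule (Clock (fst e)) Blank Blank (Blank # m_blanks) (map tape_read (snd e))
        (Clock q1) (Blank, Stay) (Bit b, MoveRight) ((Bit b, MoveRight) # keep m_blanks) as1"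
      using r b(1) by (rule clock_step)
    then show "ntm_step machine (clock_conf v s x o' e) d"
      unfolding clock_conf_step_iff[OF ok]
      by (intro exI conjI) (assumption, simp add: b(2) e' clock_conf_def)
  qed
qed

definition erase_conf :: "phase \<Rightarrow> bool list \<Rightarrow> tape list \<Rightarrow> bool list \<Rightarrow> int \<Rightarrow> bool list \<Rightarrow> nat config"
    where
  "erase_conf q v us x p o' = conf q (bit_tape v (int (length v)))
     (bit_tape o' (int (length o'))) (m_tapes x p) us"

lemma clock_conf_halt:
  assumes ok: "clock_ok e" and h: "halted C e" and "True \<in> G"
  shows "ntm_step machine (clock_conf v s x o' e) d \<longleftrightarrow>
    d = erase_conf Erase v (shift_first s (snd e)) x (int (length x) - 1) o'"
proof -
  have no: "(fst e, map tape_read (snd e), q2, as2) \<notin> table C" for q2 as2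
    using h by (auto simp: halted_def ntm_step_def)
  show ?thesis
    unfolding clock_conf_step_iff[OF ok] using clock_ok_reads[OF ok] ok \<open>True \<in> G\<close>
    by (auto simp: no erase_conf_def clock_ok_def tape_act_bit_tape_same simp del: split_paired_Ex)
qed

lemma clock_conf_halts:
  assumes ok: "clock_ok e" and h: "halted C e" and "True \<notin> G"
  shows "\<not> ntm_step machine (clock_conf v s x o' e) d"
proof -
  have no: "(fst e, map tape_read (snd e), q2, as2) \<notin> table C" for q2 as2
    using h by (auto simp: halted_def ntm_step_def)
  show ?thesis
    unfolding clock_conf_step_iff[OF ok] using \<open>True \<notin> G\<close> no by auto
qed

text \<open>The guess is visible in the last written cell of the output tape; so different guesses
  count as different successors.\<close>

lemma inj_clock_conf: "inj (\<lambda>b. clock_conf v s (x @ [b]) (o' @ [b]) e)"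
proof (rule injI)
  fix b b' assume "clock_conf v s (x @ [b]) (o' @ [b]) e = clock_conf v s (x @ [b']) (o' @ [b']) e"
  then have "fst (input_tape (o' @ [b])) (int (length o')) =
      fst (input_tape (o' @ [b'])) (int (length o'))"
    by (simp add: clock_conf_def conf_def bit_tape_def)
  then show "b = b'" by (simp add: input_tape_def)
qed

text \<open>The clock does not see the guesses, so all branches follow the same clock run
  \<open>es\<close> and make equally many guesses: one for each of its \<open>length es - 1\<close>
  steps.\<close>

lemma unfold_clock:
  assumes "clock_ok e" and "es \<in> runs (ntm_step C) e"
    and "\<And>y. length y = length es - 1 \<Longrightarrow> set y \<subseteq> G \<Longrightarrow>
      unfold (clock_conf v s (x @ y) (o' @ y) (last es)) t (F y)"
  shows "unfold (clock_conf v s x o' e) (length es - 1 + t)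
    (\<Sum>y | length y = length es - 1 \<and> set y \<subseteq> G. F y)"
  using assms
proof (induction es arbitrary: e x o' F)
  case Nil
  then show ?case by (simp add: runs_def)
next
  case (Cons e0 es)
  then have [simp]: "e0 = e" by (auto simp: runs_def)
  show ?case
  proof (cases "es = []")
    case True
    have "{y. y = [] \<and> set y \<subseteq> G} = {[]}" by auto
    with True Cons.prems(3)[of "[]"] show ?thesis by simp
  next
    case False
    then obtain k where k: "length es = Suc k" by (cases es) auto
    have st: "ntm_step C e (hd es)" and run: "es \<in> runs (ntm_step C) (hd es)"
      using Cons.prems(2) False by (auto simp: runs_def successively_Cons)
    have ok: "clock_ok (hd es)" using clock_ok_step[OF Cons.prems(1) st] .
    have "unfold (clock_conf v s (x @ [b]) (o' @ [b]) (hd es)) (length es - 1 + t)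
        (\<Sum>y | length y = length es - 1 \<and> set y \<subseteq> G. F (b # y))" if "b \<in> G" for b
      using Cons.prems(3)[of "b # _"] that False k
      by (intro Cons.IH ok run) auto
    then have "unfold (clock_conf v s x o' e) (Suc (length es - 1 + t))
        (\<Sum>b \<in> G. \<Sum>y | length y = length es - 1 \<and> set y \<subseteq> G. F (b # y))"
      by (intro unfolds_branch[where R = "ntm_step machine" and B = G and
            f = "\<lambda>b. clock_conf v s (x @ [b]) (o' @ [b])
              (hd es)", OF clock_conf_step[OF Cons.prems(1) st]] G_nonempty
          inj_on_subset[OF inj_clock_conf]) auto
    then show ?thesis using k by (simp add: sum_words_Suc)
  qed
qed

lemma clock_ok_last: "es \<in> runs (ntm_step C) e \<Longrightarrow> clock_ok e \<Longrightarrow> clock_ok (last es)"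
proof (induction es arbitrary: e)
  case (Cons e0 es)
  then have "e0 = e" by (auto simp: runs_def)
  show ?case
  proof (cases "es = []")
    case False
    then have "ntm_step C e (hd es)" "es \<in> runs (ntm_step C) (hd es)"
      using Cons.prems(1) by (auto simp: runs_def successively_Cons)
    then show ?thesis using Cons False clock_ok_step by auto
  qed (use Cons.prems \<open>e0 = e\<close> in simp)
qed (simp add: runs_def)

section \<open>Choice of the prefix length and simulation of \<open>M\<close>\<close>

lemma erase_conf_step_iff:
  assumes "map tape_read us \<in> clock_reads"
  shows "ntm_step machine (erase_conf q v us x p o') d \<longleftrightarrow>
    (\<exists>q' \<alpha> \<beta> as as'.
       rule q Blank Blank (tape_read (bit_tape x p) # m_blanks) (map tape_read us) q' \<alpha> \<beta> as as' \<and>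
       d = conf q' (tape_act \<alpha> (bit_tape v (int (length v)))) (tape_act \<beta> (bit_tape o' (int
           (length o'))))
         (map2 tape_act as (m_tapes x p)) (map2 tape_act as' us))"
  unfolding erase_conf_def using assms
  by (subst step_iff) (simp_all add: tape_count_M(2) clock_reads_def rules_def)

definition sim_conf :: "bool list \<Rightarrow> tape list \<Rightarrow> bool list \<Rightarrow> nat config \<Rightarrow> nat config" where
  "sim_conf v us o' e = conf (Sim (fst e)) (bit_tape v (int (length v)))
     (bit_tape o' (int (length o'))) (snd e) us"

context
  fixes us :: "tape list"
  assumes us: "map tape_read us \<in> clock_reads" and sim: "True \<in> G"
begin

lemma rewind_step:
  "k < length x \<Longrightarrow> ntm_step machine (erase_conf Rewind v us x (int (Suc k) - 1) o') d \<longleftrightarrow>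
    d = erase_conf Rewind v us x (int k - 1) o'"
  "ntm_step machine (erase_conf Rewind v us x (- 1) o') d \<longleftrightarrow>
    d = sim_conf v us o' (init_config M x)"
  unfolding erase_conf_step_iff[OF us] using us sim
  by (auto simp: erase_conf_def sim_conf_def tape_act_bit_tape_same tape_read_bit_tape
      init_config_def bit_tape_0 simp del: split_paired_Ex)

lemma erase_step:
  "ntm_step machine (erase_conf Erase v us (x @ [b]) (int (length x)) o') d \<longleftrightarrow>
    d = erase_conf Erase v us x (int (length x) - 1) (o' @ [True]) \<or>
    d = erase_conf Rewind v us (x @ [b]) (int (length x)) o'"
  "ntm_step machine (erase_conf Erase v us [] (- 1) o') d \<longleftrightarrow>
    d = erase_conf Rewind v us [] (- 1) o'"
  unfolding erase_conf_step_iff[OF us] using us sim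
  by (auto simp: erase_conf_def tape_act_bit_tape_same tape_read_bit_tape tape_act_erase_last
      conj_disj_distribR ex_disj_distrib simp del: split_paired_Ex)

text \<open>From cell k - 1 the head needs k steps to the blank in cell -1, and one more to enter
  cell 0 and start \<open>M\<close>. This covers k = 0, where the head is already on that
  blank.\<close>

lemma unfold_rewind:
  "k \<le> length x \<Longrightarrow> unfold (sim_conf v us o' (init_config M x)) t F \<Longrightarrow>
    unfold (erase_conf Rewind v us x (int k - 1) o') (Suc (k + t)) F"
proof (induction k)
  case 0
  then show ?case using unfold_one[OF rewind_step(2)] by simp
next
  case (Suc k)
  then have "unfold (erase_conf Rewind v us x (int k - 1) o') (Suc (k + t)) F" by simp
  then have "unfold (erase_conf Rewind v us x (int (Suc k) - 1) o') (Suc (Suc (k + t))) F"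
    using Suc.prems by (intro unfold_one[OF rewind_step(1)]) auto
  then show ?case by simp
qed

text \<open>Stopping keeps the whole word, and erasing one bit leaves the same task for a shorter
  word. Hence each length \<open>n\<close> arises on exactly one branch, with one printed mark per
  erased bit.\<close>

lemma unfold_erase:
  "(\<And>n. n \<le> length x \<Longrightarrow>
      unfold (sim_conf v us (o' @ replicate (length x - n) True) (init_config M (take n x))) t (F n)) \<Longrightarrow>
    unfold (erase_conf Erase v us x (int (length x) - 1) o') (2 * length x + 2 + t) (\<Sum>n\<le>length x. F n)"
proof (induction x arbitrary: o' rule: rev_induct)
  case Nil
  have "unfold (erase_conf Rewind v us [] (int 0 - 1) o') (Suc (0 + t)) (F 0)"
    using Nil.prems[of 0] by (intro unfold_rewind) auto
  then show ?case using unfold_one[OF erase_step(2)] by simp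
next
  case (snoc b x)
  have "unfold (sim_conf v us ((o' @ [True]) @ replicate (length x - n) True) (init_config M
      (take n x))) t (F n)"
    if "n \<le> length x" for n
    using snoc.prems[of n] that by (simp add: Suc_diff_le)
  then have 1: "unfold (erase_conf Erase v us x (int (length x) - 1) (o' @ [True]))
      (2 * length x + 2 + t) (\<Sum>n\<le>length x. F n)"
    by (rule snoc.IH)
  have "unfold (erase_conf Rewind v us (x @ [b]) (int (length (x @ [b])) - 1) o')
      (Suc (length (x @ [b]) + t)) (F (length (x @ [b])))"
    using snoc.prems[of "length (x @ [b])"] by (intro unfold_rewind) auto
  \<comment> \<open>The stopping branch is no longer than the erasing one; its bound is raised
    because both children of a node need the same one.\<close>
  then have 2: "unfold (erase_conf Rewind v us (x @ [b]) (int (length x)) o')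
      (2 * length x + 2 + t) (F (Suc (length x)))"
    by (auto intro: unfolds_mono)
  have "unfold (erase_conf Erase v us (x @ [b]) (int (length x)) o') (Suc (2 * length x + 2 + t))
      ((\<Sum>n\<le>length x. F n) + F (Suc (length x)))"
    by (rule unfolds_two[OF erase_step(1) _ 1 2]) (simp add: erase_conf_def conf_def)
  then show ?case by (auto intro: unfolds_mono)
qed

lemma sim_conf_step:
  assumes "length (snd e) = tape_count M"
  shows "ntm_step machine (sim_conf v us o' e) d \<longleftrightarrow> (\<exists>e'. ntm_step M e e' \<and> d = sim_conf v us o' e')"
proof -
  have iff: "ntm_step machine (sim_conf v us o' e) d \<longleftrightarrow> (\<exists>q' \<alpha> \<beta> as as'.
       rule (Sim (fst e)) Blank Blank (map tape_read (snd e)) (map tape_read us) q' \<alpha> \<beta> as as' \<and>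
       d = conf q' (tape_act \<alpha> (bit_tape v (int (length v)))) (tape_act \<beta> (bit_tape o' (int
           (length o'))))
         (map2 tape_act as (snd e)) (map2 tape_act as' us))"
    unfolding sim_conf_def using assms us
    by (subst step_iff) (simp_all add: clock_reads_def rules_def)
  show ?thesis
  proof
    assume "ntm_step machine (sim_conf v us o' e) d"
    then obtain q' as where "(fst e, map tape_read (snd e), q', as) \<in> table M"
      and "d = sim_conf v us o' (q', map2 tape_act as (snd e))"
      unfolding iff by (auto simp: sim_conf_def)
    then show "\<exists>e'. ntm_step M e e' \<and> d = sim_conf v us o' e'"
      unfolding ntm_step_def by blast
  next
    assume "\<exists>e'. ntm_step M e e' \<and> d = sim_conf v us o' e'"
    then obtain q' as where r: "(fst e, map tape_read (snd e), q', as) \<in> table M"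
      and d: "d = sim_conf v us o' (q', map2 tape_act as (snd e))"
      unfolding ntm_step_def by blast
    have "rule (Sim (fst e)) Blank Blank (map tape_read (snd e)) (map tape_read us)
        (Sim q') (Blank, Stay) (Blank, Stay) as (keep (map tape_read us))"
      using sim us r by (rule rule.sim_step)
    then show "ntm_step machine (sim_conf v us o' e) d"
      unfolding iff by (intro exI conjI) (assumption, simp add: d sim_conf_def)
  qed
qed

lemma length_step_M:
  "length (snd e) = tape_count M \<Longrightarrow> ntm_step M e e' \<Longrightarrow> length (snd e') = tape_count M"
  by (auto simp: ntm_step_def dest: table_M_length)

lemma inj_sim_conf: "inj (sim_conf v us o')"
  by (auto simp: inj_def sim_conf_def conf_def)

lemma length_init_M: "length (snd (init_config M x)) = tape_count M"
  by (simp add: init_config_def tape_count_M(2))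

lemma run_bound_sim:
  "run_bound (ntm_step M) (init_config M x) k \<Longrightarrow>
    run_bound (ntm_step machine) (sim_conf v us o' (init_config M x)) k"
  by (rule simulation_run_bound[where I = "\<lambda>e. length (snd e) = tape_count M"
        and R = "ntm_step M" and R' = "ntm_step machine" and f = "sim_conf v us o'",
        OF sim_conf_step length_step_M _ length_init_M])

lemma run_sum_sim:
  assumes "run_bound (ntm_step M) (init_config M x) k"
  shows "run_sum (ntm_step machine) \<phi> (sim_conf v us o' (init_config M x)) =
    run_sum (ntm_step M) (\<lambda>e. \<phi> (sim_conf v us o' e)) (init_config M x)"
proof (rule simulation_run_sum[where I = "\<lambda>e. length (snd e) = tape_count M"
        and R = "ntm_step M" and R' = "ntm_step machine" and f = "sim_conf v us o'",
        OF _ finite_branching inj_sim_conf sim_conf_step length_step_M assms length_init_M])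
  show "finite {c'. ntm_step M c c'}" for c
    using finite_successors[of M c] wf_M by (simp add: wf_ntm_def)
qed

end

end

section \<open>The martingale of prefix hits\<close>

lemma finite_bits_length: "finite {y :: bool list. length y = k \<and> P y}"
  by (rule finite_subset[OF _ finite_lists_length_eq[of UNIV k]]) auto

text \<open>The number \<open>k\<close> of random bits is a separate parameter: recursion runs over
  \<open>k\<close>, and a common \<open>k\<close> lets different \<open>n\<close> share one sample
  space. The value is the intended probability once n \<le> |w| + k; the choice k = n always
  suffices.\<close>

definition hit_prob :: "bool list set \<Rightarrow> nat \<Rightarrow> bool list \<Rightarrow> nat \<Rightarrow> real" where
  "hit_prob A n w k = real (card {y. length y = k \<and> take n (w @ y) \<in> A}) / 2 ^ k"

lemma hit_prob_nonneg: "0 \<le> hit_prob A n w k"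
  by (simp add: hit_prob_def)

lemma hit_prob_Suc:
  "hit_prob A n w (Suc k) = (hit_prob A n (w @ [False]) k + hit_prob A n (w @ [True]) k) / 2"
proof -
  let ?S = "\<lambda>w k. {y. length y = k \<and> take n (w @ y) \<in> A}"
  have "?S w (Suc k) = (#) False ` ?S (w @ [False]) k \<union> (#) True ` ?S (w @ [True]) k"
    (is "_ = ?R")
  proof (intro equalityI subsetI)
    fix y assume y: "y \<in> ?S w (Suc k)"
    then obtain b z where "y = b # z" by (cases y) auto
    with y show "y \<in> ?R" by (cases b) auto
  qed auto
  then have "card (?S w (Suc k)) = card (?S (w @ [False]) k) + card (?S (w @ [True]) k)"
    by (subst card_Un_disjoint[symmetric, of "(#) False ` ?S (w @ [False]) k" "(#) True ` ?S
        (w @ [True]) k",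
          unfolded card_image[OF inj_on_Cons1]])
      (auto simp: finite_bits_length simp del: append_assoc)
  then show ?thesis by (simp add: hit_prob_def field_simps del: append_assoc)
qed

text \<open>Bits after position \<open>n\<close> are irrelevant. The induction moves the first
  random bit into \<open>w\<close> until n \<le> |w|.\<close>

lemma hit_prob_Suc_eq:
  "n \<le> length w + k \<Longrightarrow> hit_prob A n w (Suc k) = hit_prob A n w k"
proof (induction k arbitrary: w)
  case 0
  then show ?case unfolding hit_prob_Suc by (simp add: hit_prob_def)
next
  case (Suc k)
  then show ?case
    unfolding hit_prob_Suc[of A n w "Suc k"] hit_prob_Suc[of A n w k] by simp
qed

lemma hit_prob_eq:
  assumes "n \<le> length w + k" and "n \<le> length w + l"
  shows "hit_prob A n w k = hit_prob A n w l"
proof -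
  have *: "hit_prob A n w (k + j) = hit_prob A n w k" if "n \<le> length w + k" for k j
    using that by (induction j) (auto simp: hit_prob_Suc_eq)
  show ?thesis
    using *[of k "l - k"] *[of l "k - l"] assms by (cases "k \<le> l") auto
qed

lemma hit_prob_average:
  "hit_prob A n w n = (hit_prob A n (w @ [False]) n + hit_prob A n (w @ [True]) n) / 2"
  using hit_prob_Suc_eq[of n w n A] hit_prob_Suc[of A n w n] by simp

text \<open>A nonnegative martingale at most doubles with each bit.\<close>

lemma hit_prob_le_pow: "hit_prob A n w n \<le> 2 ^ length w * hit_prob A n [] n"
proof (induction w rule: rev_induct)
  case (snoc b w)
  have "hit_prob A n (w @ [b]) n \<le> 2 * hit_prob A n w n"
    using hit_prob_average[of A n w] hit_prob_nonneg[of A n "w @ [False]" n]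
      hit_prob_nonneg[of A n "w @ [True]" n] by (cases b) auto
  with snoc show ?case by simp
qed simp

lemma hit_prob_Nil: "hit_prob A n [] n = real (card (slice A n)) / 2 ^ n"
proof -
  have "{y. length y = n \<and> take n ([] @ y) \<in> A} = slice A n" by (auto simp: slice_def)
  then show ?thesis by (simp add: hit_prob_def)
qed

lemma hit_prob_prefix:
  assumes "n \<le> length w"
  shows "hit_prob A n w n = of_bool (take n w \<in> A)"
proof -
  have "hit_prob A n w n = hit_prob A n w 0" using assms by (intro hit_prob_eq) auto
  also have "{y. length y = 0 \<and> take n (w @ y) \<in> A} = (if take n w \<in> A then {[]} else {})"
    using assms by auto
  then have "hit_prob A n w 0 = of_bool (take n w \<in> A)" by (simp add: hit_prob_def)
  finally show ?thesis .
qed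

section \<open>The sum martingale, its success and its approximation by hit counts\<close>

definition hit_martingale :: "bool list set \<Rightarrow> bool list \<Rightarrow> real" where
  "hit_martingale A w = (\<Sum>n. hit_prob A n w n)"

definition hit_count :: "bool list set \<Rightarrow> bool list \<Rightarrow> nat \<Rightarrow> nat" where
  "hit_count A w k =
     card {(y, n). length y = k \<and> n \<le> length w + k \<and> take n (w @ y) \<in> A}"

text \<open>The same \<open>k\<close> random bits determine the prefixes of all lengths up to |w| +
  k, so a single count with denominator 2^k represents the whole partial sum.\<close>

lemma hit_count_eq_sum:
  "real (hit_count A w k) / 2 ^ k = (\<Sum>n\<le>length w + k. hit_prob A n w n)"
proof -
  have "{(y, n). length y = k \<and> n \<le> length w + k \<and> take n (w @ y) \<in> A} =
      prod.swap ` (SIGMA n : {..length w + k}. {y. length y = k \<and> take n (w @ y) \<in> A})"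
    by auto
  then have "hit_count A w k =
      card (SIGMA n : {..length w + k}. {y. length y = k \<and> take n (w @ y) \<in> A})"
    by (simp add: hit_count_def card_image del: swap_product)
  also have "\<dots> = (\<Sum>n\<le>length w + k. card {y. length y = k \<and> take n (w @ y) \<in> A})"
    by (subst card_SigmaI) (auto simp: finite_bits_length)
  finally have "real (hit_count A w k) / 2 ^ k = (\<Sum>n\<le>length w + k. hit_prob A n w k)"
    by (simp add: hit_prob_def sum_divide_distrib)
  also have "\<dots> = (\<Sum>n\<le>length w + k. hit_prob A n w n)"
    by (intro sum.cong refl hit_prob_eq) auto
  finally show ?thesis .
qed

lemma hit_prob_Nil_le:
  assumes "slice A n = {} \<or> log 2 (real (card (slice A n))) < real n - real e"
  shows "hit_prob A n [] n \<le> 2 powr (- real e)"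
proof (cases "slice A n = {}")
  case True
  then show ?thesis by (simp add: hit_prob_Nil)
next
  case False
  have "finite (slice A n)"
    using finite_bits_length[of n "\<lambda>y. y \<in> A"] by (simp add: slice_def conj_commute)
  with False have pos: "0 < real (card (slice A n))" by (simp add: card_gt_0_iff)
  have "real (card (slice A n)) \<le> 2 powr (real n - real e)"
    using assms False pos by (simp add: log_less_iff less_imp_le)
  also have "\<dots> = 2 ^ n * 2 powr (- real e)"
    by (simp add: powr_diff powr_minus powr_realpow field_simps)
  finally show ?thesis by (simp add: hit_prob_Nil field_simps)
qed

lemma hit_prob_le:
  assumes "hit_prob A n [] n \<le> b"
  shows "hit_prob A n w n \<le> 2 ^ length w * b"
  using hit_prob_le_pow[of A n w] assms
      by (meson mult_left_mono order_trans zero_le_numeral zero_le_power)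

lemma hit_prob_summable:
  assumes "summable b" and "\<And>n. n \<ge> n0 \<Longrightarrow> hit_prob A n [] n \<le> b n"
  shows "summable (\<lambda>n. hit_prob A n w n)"
proof (rule summable_comparison_test')
  show "summable (\<lambda>n. 2 ^ length w * b n)" using assms(1) by (rule summable_mult)
  show "norm (hit_prob A n w n) \<le> 2 ^ length w * b n" if "n \<ge> n0" for n
    using hit_prob_le[OF assms(2)[OF that]] hit_prob_nonneg[of A n w n] by simp
qed

lemma martingale_hit_martingale:
  assumes "\<And>w. summable (\<lambda>n. hit_prob A n w n)"
  shows "martingale (hit_martingale A)"
  unfolding martingale_def
proof (intro conjI allI)
  fix w
  show "0 \<le> hit_martingale A w"
    unfolding hit_martingale_def by (intro suminf_nonneg assms hit_prob_nonneg)
  have "(\<Sum>n. hit_prob A n w n) = (\<Sum>n. (hit_prob A n (w @ [False]) n + hit_prob A n (w @ [True]) n) / 2)"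
    by (intro suminf_cong hit_prob_average)
  also have "\<dots> = (hit_martingale A (w @ [False]) + hit_martingale A (w @ [True])) / 2"
    unfolding hit_martingale_def
    by (simp only: suminf_divide summable_add assms suminf_add)
  finally show "hit_martingale A w = \<dots>" by (simp add: hit_martingale_def)
qed

lemma hit_martingale_succeeds:
  assumes sm: "\<And>w. summable (\<lambda>n. hit_prob A n w n)" and S: "S \<in> inf_often A"
  shows "succeeds_on (hit_martingale A) S"
proof -
  let ?H = "\<lambda>k. {n. n \<le> k \<and> restrict_to S n \<in> A}"
  have len: "length (restrict_to S k) = k" for k by (simp add: restrict_to_def)
  have tk: "take n (restrict_to S k) = restrict_to S n" if "n \<le> k" for n k
    using that by (simp add: restrict_to_def take_map)
  have ge: "real (card (?H k)) \<le> hit_martingale A (restrict_to S k)" for k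
  proof -
    have "real (card (?H k)) = (\<Sum>n\<le>k. of_bool (restrict_to S n \<in> A))"
      by (simp add: sum_of_bool_eq Int_def conj_commute)
    also have "\<dots> = (\<Sum>n\<le>k. hit_prob A n (restrict_to S k) n)"
      by (intro sum.cong refl) (simp add: hit_prob_prefix len tk)
    also have "\<dots> \<le> hit_martingale A (restrict_to S k)"
      unfolding hit_martingale_def by (intro sum_le_suminf sm) (auto intro: hit_prob_nonneg)
    finally show ?thesis .
  qed
  have "filterlim (\<lambda>k. hit_martingale A (restrict_to S k)) at_top sequentially"
    unfolding filterlim_at_top
  proof
    fix Z :: real
    obtain B where B: "B \<subseteq> {n. restrict_to S n \<in> A}" "finite B" "card B = nat \<lceil>Z\<rceil>"
      using S infinite_arbitrarily_large unfolding inf_often_def by blast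
    show "\<forall>\<^sub>F k in sequentially. Z \<le> hit_martingale A (restrict_to S k)"
      unfolding eventually_sequentially
    proof (intro exI allI impI)
      \<comment> \<open>From the largest element of \<open>B\<close> on, all of \<open>B\<close> is
        counted. Inserting 0 gives \<open>Max\<close> a meaning when Z \<le> 0 and \<open>B\<close>
        is empty.\<close>
      fix k assume k: "Max (insert 0 B) \<le> k"
      have "B \<subseteq> ?H k" using B k by auto
      then have "card B \<le> card (?H k)" by (intro card_mono) auto
      then show "Z \<le> hit_martingale A (restrict_to S k)"
        using ge[of k] B(3) by linarith
    qed
  qed
  then have "(\<lambda>k. ereal (hit_martingale A (restrict_to S k))) \<longlonglongrightarrow> \<infinity>"
    by (simp add: tendsto_PInfty_eq_at_top)
  then show ?thesis
    unfolding succeeds_on_def by (intro lim_imp_Limsup) auto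
qed

text \<open>The error is the tail of the series after |w| + k. There the bound \<open>b\<close> is
  valid, at the price of the factor 2^|w| for passing from the empty word to
  \<open>w\<close>.\<close>

lemma hit_martingale_approx:
  fixes b :: "nat \<Rightarrow> real"
  assumes sb: "summable b" and bb: "\<And>n. n \<ge> n0 \<Longrightarrow> hit_prob A n [] n \<le> b n"
    and b0: "\<And>n. 0 \<le> b n"
    and n0: "n0 \<le> length w + k" and m: "m \<le> length w + k" and t: "(\<Sum>n. b (n + m)) \<le> \<epsilon>"
  shows "\<bar>hit_martingale A w - real (hit_count A w k) / 2 ^ k\<bar> \<le> 2 ^ length w * \<epsilon>"
proof -
  let ?N = "Suc (length w + k)"
  let ?d = "\<lambda>n. hit_prob A n w n"
  have sd: "summable ?d" using hit_prob_summable[OF sb bb] .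
  have tail: "hit_martingale A w - real (hit_count A w k) / 2 ^ k = (\<Sum>n. ?d (n + ?N))"
    using suminf_split_initial_segment[OF sd, of ?N]
    by (simp add: hit_martingale_def hit_count_eq_sum lessThan_Suc_atMost)
  have "(\<Sum>n. ?d (n + ?N)) \<le> (\<Sum>n. 2 ^ length w * b (n + ?N))"
  proof (rule suminf_le)
    show "?d (n + ?N) \<le> 2 ^ length w * b (n + ?N)" for n
      using n0 by (intro hit_prob_le bb) simp
  qed (use sd sb in \<open>auto intro!: summable_mult summable_ignore_initial_segment[of ?d]
      summable_ignore_initial_segment[of b] simp del: add_Suc_right\<close>)
  also have "\<dots> = 2 ^ length w * (\<Sum>n. b (n + ?N))"
    using sb by (intro suminf_mult) (rule summable_ignore_initial_segment)
  \<comment> \<open>Since m < ?N, the later start only drops nonnegative terms.\<close>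
  also have "(\<Sum>n. b (n + ?N)) \<le> (\<Sum>n. b (n + m))"
  proof -
    have sm: "summable (\<lambda>n. b (n + m))" using sb by (rule summable_ignore_initial_segment)
    have "(\<Sum>n. b (n + m)) = (\<Sum>n. b (n + (?N - m) + m)) + (\<Sum>n<?N - m. b (n + m))"
      by (rule suminf_split_initial_segment[OF sm])
    moreover have "n + (?N - m) + m = n + ?N" for n using m by simp
    ultimately show ?thesis using sum_nonneg[of "{..<?N - m}" "\<lambda>n. b (n + m)"] b0 by simp
  qed
  also have "\<dots> \<le> \<epsilon>" by (rule t)
  finally have "(\<Sum>n. ?d (n + ?N)) \<le> 2 ^ length w * \<epsilon>" by simp
  moreover have "0 \<le> (\<Sum>n. ?d (n + ?N))"
    using sd by (intro suminf_nonneg hit_prob_nonneg) (rule summable_ignore_initial_segment[of ?d])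
  ultimately show ?thesis unfolding tail by simp
qed

section \<open>The running time of the modulus machine\<close>

text \<open>Steps are one fewer than configurations. The run is picked by choice, and
  \<open>clock_run\<close> supplies a run with exactly this number of steps.\<close>

definition clock_time :: "nat ntm \<Rightarrow> nat \<Rightarrow> nat" where
  "clock_time C n = length (SOME es. es \<in> runs (ntm_step C) (init_config C (unary n))) - 1"

lemma clock_run:
  assumes "run_bound (ntm_step C) (init_config C (unary n)) k"
  obtains es where "es \<in> runs (ntm_step C) (init_config C (unary n))"
    and "length es - 1 = clock_time C n"
  using someI_ex[of "\<lambda>es. es \<in> runs (ntm_step C) (init_config C (unary n))"]
    runs_nonempty[OF assms] unfolding clock_time_def by blast

lemma clock_time_le:
  assumes "run_bound (ntm_step C) (init_config C (unary n)) k"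
  shows "clock_time C n \<le> k"
proof -
  obtain es where "es \<in> runs (ntm_step C) (init_config C (unary n))" "length es - 1 = clock_time C n"
    using clock_run[OF assms] .
  then show ?thesis using assms by (force simp: runs_def run_bound_def)
qed

lemma sum_mset_sum:
  assumes "finite Y"
  shows "(\<Sum>s \<in># (\<Sum>y \<in> Y. F y). f s) = (\<Sum>y \<in> Y. \<Sum>s \<in># F y. f s)"
  using assms by (induction rule: finite_induct) auto

lemma poly_nat_mono:
  fixes p :: "nat poly"
  assumes "a \<le> b"
  shows "poly p a \<le> poly p b"
  by (induction p) (auto intro!: mult_mono assms)

lemma length_payload: "length (payload v) \<le> length v"
  unfolding payload_def using length_dropWhile_le[of Not v] by simp

lemma payload_pair_unary: "payload (pair_unary w r) = w"
  unfolding payload_def pair_unary_def unary_def by (induction r) auto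

section \<open>Computation tree and running time of the guessing machine\<close>

context prefix_guesser
begin

text \<open>Chains set-up, clock, erasing and rewinding. The leaves are copies of \<open>M\<close>
  at the start, one for each pair of guesses; \<open>us\<close> are the tapes left by the halted
  clock.\<close>

lemma unfold_guess:
  assumes es: "es \<in> runs (ntm_step C) (init_config C (unary (length v + pad)))"
    and G: "True \<in> G"
  defines "us \<equiv> shift_first (int (length v + pad) - 1) (snd (last es))" and "k \<equiv> length es - 1"
  shows "map tape_read us \<in> clock_reads"
    and "unfold (init_config machine v) (3 * length v + pad + 5 + 3 * k)
      (\<Sum>y | length y = k \<and> set y \<subseteq> G. \<Sum>n\<le>length (payload v) + k.
         {#sim_conf v us (True # y @ replicate (length (payload v) + k - n) True)
             (init_config M (take n (payload v @ y)))#})"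
proof -
  have ok: "clock_ok (last es)" using clock_ok_last[OF es clock_ok_init] .
  then show us: "map tape_read us \<in> clock_reads"
    unfolding us_def using clock_ok_reads by simp
  have h: "halted C (last es)" using es by (simp add: runs_def halted_iff_halts)
  have "unfold (clock_conf v (int (length v + pad) - 1) (payload v @ y) ([True] @ y) (last es))
      (Suc (2 * length (payload v @ y) + 2 + 0))
      (\<Sum>n\<le>length (payload v @ y). {#sim_conf v us (([True] @ y) @ replicate (length
          (payload v @ y) - n) True)
             (init_config M (take n (payload v @ y)))#})" for y
    by (rule unfold_one[OF clock_conf_halt[OF ok h G]], fold us_def)
      (intro unfold_erase[OF us G] unfolds.leaf)
  then have "unfold (clock_conf v (int (length v + pad) - 1) (payload v) [True] (init_config C
      (unary (length v + pad))))
      (k + (2 * (length v + k) + 3))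
      (\<Sum>y | length y = k \<and> set y \<subseteq> G. \<Sum>n\<le>length (payload v @ y).
         {#sim_conf v us (([True] @ y) @ replicate (length (payload v @ y) - n) True)
             (init_config M (take n (payload v @ y)))#})"
    unfolding k_def
    by (intro unfold_clock[OF clock_ok_init es])
        (rule unfolds_mono, assumption, use length_payload[of v] in auto)
  then have "unfold (init_config machine v) (length v + pad + 2 + (k + (2 * (length v + k) + 3)))
      (\<Sum>y | length y = k \<and> set y \<subseteq> G. \<Sum>n\<le>length (payload v @ y).
         {#sim_conf v us (([True] @ y) @ replicate (length (payload v @ y) - n) True)
             (init_config M (take n (payload v @ y)))#})"
    by (rule unfold_setup)
  also have "length v + pad + 2 + (k + (2 * (length v + k) + 3)) =
      3 * length v + pad + 5 + 3 * k" by simp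
  finally show "unfold (init_config machine v) (3 * length v + pad + 5 + 3 * k)
      (\<Sum>y | length y = k \<and> set y \<subseteq> G. \<Sum>n\<le>length (payload v) + k.
         {#sim_conf v us (True # y @ replicate (length (payload v) + k - n) True)
             (init_config M (take n (payload v @ y)))#})"
    by (rule back_subst[of "unfold _ _"]) (auto intro!: sum.cong)
qed

text \<open>There is just one word of \<open>k\<close> zeros to guess, so the tree is a path; it
  ends with the clock because the rule into \<open>Erase\<close> requires a one in
  \<open>G\<close>.\<close>

lemma unfold_power:
  assumes es: "es \<in> runs (ntm_step C) (init_config C (unary (length v + pad)))"
    and G: "True \<notin> G"
  defines "k \<equiv> length es - 1"
  defines "c \<equiv> clock_conf v (int (length v + pad) - 1) (payload v @ replicate k False)
      (True # replicate k False) (last es)"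
  shows "unfold (init_config machine v) (length v + pad + 2 + k) {#c#}" and "\<not> ntm_step machine c d"
proof -
  have ok: "clock_ok (last es)" using clock_ok_last[OF es clock_ok_init] .
  have h: "halted C (last es)" using es by (simp add: runs_def halted_iff_halts)
  show "\<not> ntm_step machine c d" unfolding c_def by (rule clock_conf_halts[OF ok h G])
  have "G = {False}" using G G_nonempty
      by (metis (full_types) equals0I insertI1 singletonI subsetI subset_singletonD insert_iff)
  then have "{y. length y = k \<and> set y \<subseteq> G} = {replicate k False}"
    by (auto intro!: replicate_eqI)
  moreover have "unfold (clock_conf v (int (length v + pad) - 1) (payload v) [True] (init_config C
      (unary (length v + pad))))
      (k + 0) (\<Sum>y | length y = k \<and> set y \<subseteq> G.
        {#clock_conf v (int (length v + pad) - 1) (payload v @ y) ([True] @ y) (last es)#})"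
    unfolding k_def by (intro unfold_clock[OF clock_ok_init es] unfolds.leaf)
  ultimately show "unfold (init_config machine v) (length v + pad + 2 + k) {#c#}"
    by (intro unfold_setup) (simp add: c_def)
qed

lemma guess_run_bound:
  assumes pC: "\<And>n. run_bound (ntm_step C) (init_config C (unary n)) (poly pC n)"
    and pM: "\<And>x. run_bound (ntm_step M) (init_config M x) (poly pM (length x))"
    and G: "True \<in> G"
  shows "run_bound (ntm_step machine) (init_config machine v)
    (3 * length v + pad + 5 + 3 * poly pC (length v + pad) + poly pM (length v + poly pC
        (length v + pad)))"
proof -
  let ?N = "length v + pad"
  obtain es where es: "es \<in> runs (ntm_step C) (init_config C (unary ?N))"
    and k: "length es - 1 = clock_time C ?N" using clock_run[OF pC] .
  note uf = unfold_guess[OF es G, unfolded k]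
  have kp: "clock_time C ?N \<le> poly pC ?N" using clock_time_le[OF pC] .
  let ?b = "poly pM (length v + poly pC ?N)"
  have "run_bound (ntm_step machine) (init_config machine v)
      (3 * length v + pad + 5 + 3 * clock_time C ?N + ?b)"
  proof (rule unfolds_run_bound[OF finite_branching uf(2)])
    fix s assume "s \<in># (\<Sum>y | length y = clock_time C ?N \<and>
        set y \<subseteq> G. \<Sum>n\<le>length (payload v) + clock_time C ?N.
         {#sim_conf v (shift_first (int ?N - 1) (snd (last es)))
             (True # y @ replicate (length (payload v) + clock_time C ?N - n) True)
             (init_config M (take n (payload v @ y)))#})"
    then obtain o' y n where s: "s = sim_conf v (shift_first (int ?N - 1) (snd (last es))) o'
             (init_config M (take n (payload v @ y)))" and y: "length y = clock_time C ?N"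
      by (auto simp: set_mset_sum finite_bits_length)
    have "length (take n (payload v @ y)) \<le> length v + poly pC ?N"
      using y kp length_payload[of v] by simp
    then have "run_bound (ntm_step M) (init_config M (take n (payload v @ y))) ?b"
      by (rule run_bound_mono[OF pM poly_nat_mono])
    then show "run_bound (ntm_step machine) s ?b"
      unfolding s by (rule run_bound_sim[OF uf(1) G])
  qed
  then show ?thesis by (rule run_bound_mono) (use kp in simp)
qed

lemma guess_poly_time:
  assumes "poly_time C" and "poly_time M" and G: "True \<in> G"
  shows "poly_time machine"
proof -
  obtain pC pM where pC: "\<And>x. run_bound (ntm_step C) (init_config C x) (poly pC (length x))"
    and pM: "\<And>x. run_bound (ntm_step M) (init_config M x) (poly pM (length x))"
    using assms by (auto simp: poly_time_iff_run_bound)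
  have pC': "run_bound (ntm_step C) (init_config C (unary n)) (poly pC n)" for n
    using pC[of "unary n"] by (simp add: unary_def)
  \<comment> \<open>\<open>[:pad, 1:]\<close> is n + pad, the length of the clock input for an input
    of length n.\<close>
  let ?q = "pcompose pC [:pad, 1:]"
  have "run_bound (ntm_step machine) (init_config machine v)
      (poly ([:pad + 5, 3:] + smult 3 ?q + pcompose pM ([:0, 1:] + ?q)) (length v))" for v
    using guess_run_bound[OF pC' pM G, of v] by (simp add: poly_pcompose algebra_simps)
  then show ?thesis unfolding poly_time_iff_run_bound by blast
qed

lemma power_poly_time:
  assumes "poly_time C" and G: "True \<notin> G"
  shows "poly_time machine"
proof -
  obtain pC where pC: "\<And>x. run_bound (ntm_step C) (init_config C x) (poly pC (length x))"
    using assms by (auto simp: poly_time_iff_run_bound)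
  have pC': "run_bound (ntm_step C) (init_config C (unary n)) (poly pC n)" for n
    using pC[of "unary n"] by (simp add: unary_def)
  have "run_bound (ntm_step machine) (init_config machine v)
      (poly ([:pad + 3, 1:] + pcompose pC [:pad, 1:]) (length v))" for v
  proof -
    let ?N = "length v + pad"
    obtain es where es: "es \<in> runs (ntm_step C) (init_config C (unary ?N))"
      and k: "length es - 1 = clock_time C ?N" using clock_run[OF pC'] .
    note uf = unfold_power[OF es G, unfolded k]
    \<comment> \<open>The last summand is the single configuration of a halted leaf.\<close>
    have "run_bound (ntm_step machine) (init_config machine v) (?N + 2 + clock_time C ?N + Suc 0)"
      by (rule unfolds_run_bound[OF finite_branching uf(1)])
          (auto simp only: run_bound_Suc uf(2) set_mset_add_mset_insert set_mset_empty singleton_iff)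
    then show ?thesis
      by (rule run_bound_mono) (use clock_time_le[OF pC', of ?N] in \<open>simp add: poly_pcompose
          algebra_simps\<close>)
  qed
  then show ?thesis unfolding poly_time_iff_run_bound by blast
qed

text \<open>Without \<open>True\<close> in \<open>G\<close> the competing erase rules are absent and
  the guessed bit is forced; the remaining choice is the move of the deterministic clock.\<close>

lemma power_deterministic:
  assumes G: "True \<notin> G"
  shows "deterministic machine"
proof -
  have "q1' = q2' \<and> \<alpha>1 = \<alpha>2 \<and> \<beta>1 = \<beta>2 \<and> as1 = as2 \<and> bs1 = bs2"
    if 1: "rule q a b rs rs' q1' \<alpha>1 \<beta>1 as1 bs1" and 2: "rule q a b rs rs' q2' \<alpha>2 \<beta>2 as2 bs2"
    for q a b rs rs' q1' \<alpha>1 \<beta>1 as1 bs1 q2' \<alpha>2 \<beta>2 as2 bs2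
  proof -
    have x: "x = False" if "x \<in> G" for x using that G by (cases x) auto
    have t: "x = y \<and> us = ws" if "(p, ts, x, us) \<in> table C" "(p, ts, y, ws) \<in> table C"
        for p ts x us y ws
      using that det_C unfolding deterministic_def by blast
    show ?thesis
    proof (cases q)
      case (Clock p)
      then show ?thesis using 1 2 G by (auto dest: x t)
    qed (use 1 2 G in auto)
  qed
  note uq = this
  show ?thesis
    unfolding deterministic_def
  proof (intro allI impI)
    fix q rs q1 as1 q2 as2
    assume *: "(q, rs, q1, as1) \<in> table machine \<and> (q, rs, q2, as2) \<in> table machine"
    then obtain p1 a1 b1 rs1 rs1' p1' \<alpha>1 \<beta>1 as1' bs1 where
      r1: "(p1, a1, b1, rs1, rs1', p1', \<alpha>1, \<beta>1, as1', bs1) \<in> rules"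
      and e1: "(q, rs, q1, as1) = entry (p1, a1, b1, rs1, rs1', p1', \<alpha>1, \<beta>1, as1', bs1)"
      by (auto simp: machine_def)
    from * obtain p2 a2 b2 rs2 rs2' p2' \<alpha>2 \<beta>2 as2' bs2 where
      r2: "(p2, a2, b2, rs2, rs2', p2', \<alpha>2, \<beta>2, as2', bs2) \<in> rules"
      and e2: "(q, rs, q2, as2) = entry (p2, a2, b2, rs2, rs2', p2', \<alpha>2, \<beta>2, as2', bs2)"
      by (auto simp: machine_def)
    have "p1 = p2" "a1 = a2" "b1 = b2" "rs1 @ rs1' = rs2 @ rs2'" using e1 e2 by (auto simp: entry_def)
    then have "p1 = p2" "a1 = a2" "b1 = b2" "rs1 = rs2" "rs1' = rs2'"
      using rules_length[OF r1] rules_length[OF r2] by auto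
    with uq r1 r2 have "p1' = p2'" "\<alpha>1 = \<alpha>2" "\<beta>1 = \<beta>2" "as1' = as2'" "bs1 = bs2"
      unfolding rules_def mem_Collect_eq prod.case by blast+
    with e1 e2 show "q1 = q2 \<and> as1 = as2" by (simp add: entry_def)
  qed
qed

text \<open>The left-over clock tapes \<open>us\<close> depend only on \<open>v\<close> and come
  before \<phi>, so one choice of them serves every \<phi>.\<close>

lemma guess_run_sum:
  assumes C: "poly_time C" and M: "poly_time M" and G: "True \<in> G"
  defines "k \<equiv> \<lambda>v. clock_time C (length v + pad)"
  shows "\<exists>us. \<forall>\<phi>. run_sum (ntm_step machine) \<phi> (init_config machine v) =
    (\<Sum>y | length y = k v \<and> set y \<subseteq> G. \<Sum>n\<le>length (payload v) + k v.
       run_sum (ntm_step M)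
         (\<lambda>e. \<phi> (sim_conf v us (True # y @ replicate (length (payload v) + k v - n) True) e))
         (init_config M (take n (payload v @ y))))"
proof -
  obtain pC where pC: "\<And>x. run_bound (ntm_step C) (init_config C x) (poly pC (length x))"
    using C by (auto simp: poly_time_iff_run_bound)
  obtain pM where pM: "\<And>x. run_bound (ntm_step M) (init_config M x) (poly pM (length x))"
    using M by (auto simp: poly_time_iff_run_bound)
  obtain p where p: "\<And>x. run_bound (ntm_step machine) (init_config machine x) (poly p (length x))"
    using guess_poly_time[OF C M G] by (auto simp: poly_time_iff_run_bound)
  obtain es where es: "es \<in> runs (ntm_step C) (init_config C (unary (length v + pad)))"
    and k: "length es - 1 = k v" using clock_run[OF pC] unfolding k_def .
  note uf = unfold_guess[OF es G, unfolded k]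
  show ?thesis
    by (intro exI[of _ "shift_first (int (length v + pad) - 1) (snd (last es))"] allI)
      (simp only: unfolds_run_sum[OF finite_branching uf(2) p] sum_mset_sum finite_bits_length
          finite_atMost
        image_mset_single sum_mset.singleton run_sum_sim[OF uf(1) G pM] cong: sum.cong)
qed

lemma accept_sim_conf: "fst (sim_conf v us o' e) \<in> accept_states machine \<longleftrightarrow> fst e \<in> accept_states M"
  by (auto simp: sim_conf_def conf_def machine_def)

lemma outputs_sim_conf: "outputs (sim_conf v us o' e) z \<longleftrightarrow> z = o'"
  by (rule outputs_bit_tape[of _ _ "int (length o')"]) (simp add: sim_conf_def conf_def)

end

section \<open>Path counts as run sums, and computability of the power 2^N\<close>

lemma finite_paths:
  assumes "poly_ntm M"
  shows "finite (paths M x)"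
proof -
  obtain p where b: "run_bound (ntm_step M) (init_config M x) (poly p (length x))"
    using assms by (auto simp: poly_ntm_def poly_time_iff_run_bound)
  have f: "finite {c'. ntm_step M c c'}" for c
    using finite_successors[of M c] assms by (simp add: poly_ntm_def wf_ntm_def)
  show ?thesis unfolding paths_eq_runs by (rule finite_runs[OF f b])
qed

lemma card_paths_eq_run_sum:
  assumes "poly_ntm M"
  shows "int (card {cs \<in> paths M x. P (last cs)}) =
    run_sum (ntm_step M) (\<lambda>e. of_bool (P e)) (init_config M x)"
  using finite_paths[OF assms, of x] unfolding run_sum_def paths_eq_runs
  by (simp add: sum_of_bool_eq Int_def)

lemma card_accepting_eq_run_sum:
  assumes "poly_ntm M"
  shows "int (card (accepting_paths M x)) =
    run_sum (ntm_step M) (\<lambda>e. of_bool (fst e \<in> accept_states M)) (init_config M x)"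
  unfolding accepting_paths_def by (rule card_paths_eq_run_sum[OF assms])

text \<open>Every maximal run accepts or rejects, so the gap is the run sum of a sign. As such it is
  additive over the leaves of the guessing machine, and cancellation happens below each leaf
  separately.\<close>

lemma gap_eq_run_sum:
  assumes "poly_ntm M"
  shows "int (card (accepting_paths M x)) - int (card (rejecting_paths M x)) =
    run_sum (ntm_step M) (\<lambda>e. if fst e \<in> accept_states M then 1 else - 1) (init_config M x)"
proof -
  have "int (card (accepting_paths M x)) - int (card (rejecting_paths M x)) =
      run_sum (ntm_step M) (\<lambda>e. of_bool (fst e \<in> accept_states M) - of_bool (fst e \<notin> accept_states M))
        (init_config M x)"
    unfolding accepting_paths_def rejecting_paths_def
      card_paths_eq_run_sum[OF assms, of x "\<lambda>e. fst e \<in> accept_states M"]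
      card_paths_eq_run_sum[OF assms, of x "\<lambda>e. fst e \<notin> accept_states M"]
    by (simp add: run_sum_def sum_subtractf)
  also have "\<dots> = run_sum (ntm_step M) (\<lambda>e. if fst e \<in> accept_states M then 1 else - 1)
      (init_config M x)"
    unfolding run_sum_def by (intro sum.cong) auto
  finally show ?thesis .
qed

lemma binary_power_2: "binary (2 ^ k) = True # replicate k False"
proof (induction k)
  case (Suc k)
  have "binary (2 ^ Suc k) = binary (2 ^ k) @ [False]"
    by (subst binary.simps) (simp add: one_le_power less_le_trans[OF _ one_le_power])
  then show ?case using Suc by (simp add: replicate_append_same)
qed (simp add: binary.simps)

lemma hit_count_sum:
  "int (hit_count A w k) =
    (\<Sum>y | length y = k. \<Sum>n\<le>length w + k. of_bool (take n (w @ y) \<in> A))"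
proof -
  have "{(y, n). length y = k \<and> n \<le> length w + k \<and> take n (w @ y) \<in> A} =
      (SIGMA y : {y. length y = k}. {n \<in> {..length w + k}. take n (w @ y) \<in> A})" by auto
  then have "hit_count A w k = (\<Sum>y | length y = k. card {n \<in> {..length w + k}. take n (w @ y) \<in> A})"
    unfolding hit_count_def using finite_bits_length[of k "\<lambda>_. True"] by (simp add: card_SigmaI)
  then show ?thesis by (simp add: sum_of_bool_eq Int_def)
qed

lemma power_clock_computable:
  assumes C: "poly_ntm C" and det: "deterministic C"
  shows "poly_computable_pair_to_binary (\<lambda>w r. 2 ^ clock_time C (length (pair_unary w r) + pad))"
proof -
  \<comment> \<open>With zeros as the only guesses the machine stops together with the clock, so
    \<open>C\<close> can also stand in the place of \<open>M\<close>.\<close>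
  interpret prefix_guesser C C pad "{False}"
    using C det by unfold_locales (auto simp: poly_ntm_def)
  obtain pC where pC: "\<And>x. run_bound (ntm_step C) (init_config C x) (poly pC (length x))"
    using C by (auto simp: poly_ntm_def poly_time_iff_run_bound)
  let ?h = "\<lambda>v. binary (2 ^ clock_time C (length v + pad))"
  have "outputs (last cs) (?h v)" if cs: "cs \<in> paths machine v" for v cs
  proof -
    obtain es where es: "es \<in> runs (ntm_step C) (init_config C (unary (length v + pad)))"
      and k: "length es - 1 = clock_time C (length v + pad)" using clock_run[OF pC] .
    note uf = unfold_power[OF es, simplified, unfolded k[simplified]]
    obtain ds where "ds \<in> runs (ntm_step machine) (clock_conf v (int (length v + pad) - 1)
        (payload v @ replicate (clock_time C (length v + pad)) False)
        (True # replicate (clock_time C (length v + pad)) False) (last es))" "last cs = last ds"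
      using unfolds_last[OF finite_branching uf(1)] cs unfolding paths_eq_runs by auto
    then have "last cs = clock_conf v (int (length v + pad) - 1)
        (payload v @ replicate (clock_time C (length v + pad)) False)
        (True # replicate (clock_time C (length v + pad)) False) (last es)"
      using uf(2) by (subst (asm) runs_halted) (auto simp: halts_def)
    then show ?thesis
      unfolding binary_power_2
      by (subst outputs_bit_tape) (auto simp: clock_conf_def conf_def)
  qed
  moreover have "poly_ntm machine" "deterministic machine"
    using C wf_machine power_poly_time power_deterministic by (simp_all add: poly_ntm_def)
  ultimately have "?h \<in> FP" unfolding FP_def by blast
  then show ?thesis
    unfolding poly_computable_pair_to_binary_def by (rule rev_bexI) (rule allI refl)+
qed

text \<open>A step changes only the cell under the head, so it adds at most one nonblank cell to the
  output tape. The tape count is carried along so that tape 1 exists throughout.\<close>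

lemma card_written_le_steps:
  assumes "successively (ntm_step M) cs" and "cs \<noteq> []" and "snd (hd cs) ! 1 = blank_tape"
    and "wf_ntm M" and "length (snd (hd cs)) = tape_count M"
  shows "length (snd (last cs)) = tape_count M \<and> finite {i. fst (snd (last cs) ! 1) i \<noteq> Blank} \<and>
    card {i. fst (snd (last cs) ! 1) i \<noteq> Blank} \<le> length cs - 1"
  using assms
proof (induction cs rule: rev_induct)
  case (snoc c cs)
  show ?case
  proof (cases "cs = []")
    case True
    with snoc.prems show ?thesis by (simp add: blank_tape_def)
  next
    case False
    let ?B = "\<lambda>c. {i. fst (snd c ! 1) i \<noteq> Blank}"
    have IH: "length (snd (last cs)) = tape_count M" "finite (?B (last cs))"
        "card (?B (last cs)) \<le> length cs - 1" and st: "ntm_step M (last cs) c"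
      using snoc False by (auto simp: successively_append_iff)
    obtain q' as where r: "(fst (last cs), map tape_read (snd (last cs)), q', as) \<in> table M"
      and c: "c = (q', map2 tape_act as (snd (last cs)))"
      using st by (auto simp: ntm_step_def)
    have len: "length as = tape_count M" "2 \<le> tape_count M"
      using r \<open>wf_ntm M\<close> by (auto simp: wf_ntm_def)
    then have "snd c ! 1 = tape_act (as ! 1) (snd (last cs) ! 1)"
      using IH(1) by (simp add: c)
    then have sub: "?B c \<subseteq> insert (snd (snd (last cs) ! 1)) (?B (last cs))"
      by (auto simp: tape_act_def)
    then have "card (?B c) \<le> Suc (card (?B (last cs)))"
      using card_mono[OF _ sub] IH(2) by (simp add: card_insert_if split: if_splits)
    moreover have "length cs \<noteq> 0" using False by simp
    moreover have "finite (?B c)" using sub IH(2) by (meson finite_insert finite_subset)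
    moreover have "length (snd c) = tape_count M" using IH(1) len by (simp add: c)
    ultimately show ?thesis using IH(3) by (cases cs) auto
  qed
qed simp

lemma output_length_le_clock_time:
  assumes C: "poly_ntm C" and out: "\<And>cs. cs \<in> paths C (unary n) \<Longrightarrow> outputs (last cs) y"
  shows "length y \<le> clock_time C n"
proof -
  obtain pC where pC: "\<And>x. run_bound (ntm_step C) (init_config C x) (poly pC (length x))"
    using C by (auto simp: poly_ntm_def poly_time_iff_run_bound)
  obtain es where es: "es \<in> runs (ntm_step C) (init_config C (unary n))"
    and k: "length es - 1 = clock_time C n" using clock_run[OF pC] .
  let ?B = "{i. fst (snd (last es) ! 1) i \<noteq> Blank}"
  have "outputs (last es) y" using out es by (simp add: paths_eq_runs)
  then have "int ` {..<length y} \<subseteq> ?B" by (auto simp: outputs_def)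
  moreover have "2 \<le> tape_count C" "wf_ntm C" using C by (auto simp: poly_ntm_def wf_ntm_def)
  then have "finite ?B" "card ?B \<le> clock_time C n"
    using card_written_le_steps[of C es] es k by (auto simp: runs_def init_config_def)
  ultimately have "card (int ` {..<length y}) \<le> clock_time C n"
    by (meson card_mono order_trans)
  then show ?thesis by (simp add: card_image)
qed

section \<open>Measure zero sets\<close>

text \<open>Isolates the covering language, so that its machine can be fixed before the measure
  argument is applied.\<close>

lemma M_measure_zero_singleton: "M_measure_zero \<C> X \<Longrightarrow> \<exists>A \<in> \<C>. M_measure_zero {A} X"
  unfolding M_measure_zero_def by blast

text \<open>The part common to the three cases: the classes differ only in how hits are counted by a
  function of \<Delta>.\<close>

lemma class_measure_zeroI:
  assumes "M_measure_zero {A} X"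
    and cnt: "\<And>C pad. poly_ntm C \<Longrightarrow> deterministic C \<Longrightarrow> \<exists>F \<in> \<Delta>. \<forall>w r.
      F (pair_unary w r) = int (hit_count A w (clock_time C (length (pair_unary w r) + pad)))"
  shows "class_measure_zero \<Delta> X"
proof -
  obtain f where X: "X \<subseteq> inf_often A"
    and sl: "\<forall>\<^sub>F n in sequentially. slice A n =
        {} \<or> log 2 (real (card (slice A n))) < real n - real (f n)"
    and pc: "p_convergent (\<lambda>n. 2 powr (- real (f n)))"
    using assms(1) unfolding M_measure_zero_def by blast
  define b :: "nat \<Rightarrow> real" where "b n = 2 powr (- real (f n))" for n
  obtain m where sb: "summable b" and m: "poly_computable_unary_to_unary m"
    and tail: "\<And>i. (\<Sum>n. b (n + m i)) \<le> 2 powr (- real i)"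
    using pc unfolding p_convergent_def b_def by blast
  obtain C h where C: "poly_ntm C" "deterministic C"
    and h: "\<And>x cs. cs \<in> paths C x \<Longrightarrow> outputs (last cs) (h x)" "\<And>n. h (unary n) = unary (m n)"
    using m unfolding poly_computable_unary_to_unary_def FP_def by blast
  have m_le: "m n \<le> clock_time C n" for n
    using output_length_le_clock_time[OF C(1), of n "unary (m n)"] h(1)[of _ "unary n"] h(2)[of n]
    by (simp add: unary_def)
  obtain n0 where n0: "\<And>n. n \<ge> n0 \<Longrightarrow> slice A n =
      {} \<or> log 2 (real (card (slice A n))) < real n - real (f n)"
    using sl by (auto simp: eventually_sequentially)
  have bb: "hit_prob A n [] n \<le> b n" if "n \<ge> n0" for n
    unfolding b_def by (rule hit_prob_Nil_le[OF n0[OF that]])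
  have b0: "0 \<le> b n" for n by (simp add: b_def)
  have sh: "summable (\<lambda>n. hit_prob A n w n)" for w by (rule hit_prob_summable[OF sb bb])
  \<comment> \<open>For i \<ge> \<open>pad\<close> this makes 2^(-i) smaller than
    \<open>b n0\<close>.\<close>
  define pad where "pad = Suc (f n0)"
  \<comment> \<open>All terms of the series are positive, so its modulus exceeds any given index eventually.\<close>
  have n0_less: "n0 < m i" if "pad \<le> i" for i
  proof (rule ccontr)
    assume "\<not> n0 < m i"
    \<comment> \<open>If m i \<le> n0, then \<open>b n0\<close> is itself a term of the tail, at
      index n0 - m i.\<close>
    then have "b n0 = (\<Sum>n \<in> {n0 - m i}. b (n + m i))" by simp
    also have "\<dots> \<le> (\<Sum>n. b (n + m i))"
      by (intro sum_le_suminf summable_ignore_initial_segment[OF sb]) (auto simp: b0)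
    also have "\<dots> \<le> 2 powr (- real i)" by (rule tail)
    also have "\<dots> < 2 powr (- real (f n0))" using that by (simp add: pad_def)
    finally show False by (simp add: b_def)
  qed
  define k where "k w r = clock_time C (length (pair_unary w r) + pad)" for w r
  obtain F where F: "F \<in> \<Delta>" "\<And>w r. F (pair_unary w r) = int (hit_count A w (k w r))"
    using cnt[OF C, of pad] unfolding k_def by blast
  have approx: "\<bar>hit_martingale A w - real_of_int (F (pair_unary w r)) / real (2 ^ k w r)\<bar> \<le> 2 powr
      (- real r)"
    for w r
  proof -
    \<comment> \<open>This is |w| + r + 1 + pad: the part |w| absorbs the factor 2^|w|, r gives the
      precision, and \<open>pad\<close> makes the modulus exceed \<open>n0\<close>.\<close>
    let ?i = "length (pair_unary w r) + pad"
    have "m ?i \<le> k w r" unfolding k_def by (rule m_le)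
    moreover have "n0 < m ?i" by (rule n0_less) simp
    ultimately have "\<bar>hit_martingale A w - real (hit_count A w (k w r)) / 2 ^ k w r\<bar>
        \<le> 2 ^ length w * 2 powr (- real ?i)"
      by (intro hit_martingale_approx[OF sb bb b0 _ _ tail]) auto
    also have "2 ^ length w * 2 powr (- real ?i) = 2 powr (real (length w) + - real ?i)"
      by (subst powr_add) (simp add: powr_realpow)
    also have "\<dots> \<le> 2 powr (- real r)" by (simp add: pair_unary_def unary_def)
    finally show ?thesis by (simp add: F(2))
  qed
  have "class_martingale \<Delta> (hit_martingale A)"
    unfolding class_martingale_def
  proof (intro conjI bexI[OF _ F(1)] exI[of _ "\<lambda>w r. 2 ^ k w r"] allI)
    show "martingale (hit_martingale A)" by (rule martingale_hit_martingale[OF sh])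
    show "poly_computable_pair_to_binary (\<lambda>w r. 2 ^ k w r)"
      unfolding k_def by (rule power_clock_computable[OF C])
  qed (use approx in auto)
  moreover have "succeeds_on (hit_martingale A) S" if "S \<in> X" for S
    using hit_martingale_succeeds[OF sh] X that by blast
  ultimately show ?thesis unfolding class_measure_zero_def by blast
qed

section \<open>Counting hits in #P, GapP and SpanP\<close>

context
  fixes C M :: "nat ntm" and pad :: nat
  assumes C: "poly_ntm C" "deterministic C" and M: "poly_ntm M"
begin

interpretation prefix_guesser C M pad UNIV
  using C M by unfold_locales (auto simp: poly_ntm_def)

abbreviation guesses :: "bool list \<Rightarrow> nat \<Rightarrow> nat" where
  "guesses w r \<equiv> clock_time C (length (pair_unary w r) + pad)"

lemma poly_ntm_guesser: "poly_ntm machine"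
  using C M wf_machine guess_poly_time by (simp add: poly_ntm_def)

lemma guesser_run_sum:
  "\<exists>us. \<forall>\<phi>. run_sum (ntm_step machine) \<phi> (init_config machine (pair_unary w r)) =
    (\<Sum>y | length y = guesses w r.
      \<Sum>n\<le>length w + guesses w r.
       run_sum (ntm_step M) (\<lambda>e. \<phi> (sim_conf (pair_unary w r) us
           (True # y @ replicate (length w + guesses w r - n) True) e))
         (init_config M (take n (w @ y))))"
  using guess_run_sum[of "pair_unary w r"] C M by (simp add: poly_ntm_def payload_pair_unary)

text \<open>Below each leaf \<open>M\<close> has one accepting path if the prefix is in
  \<open>A\<close> and none otherwise, so accepting paths count hits.\<close>

lemma SharpP_hit_count:
  assumes A: "\<And>x. int (card (accepting_paths M x)) = of_bool (x \<in> A)"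
  shows "\<exists>F \<in> SharpP. \<forall>w r.
    F (pair_unary w r) = int (hit_count A w (guesses w r))"
proof (intro bexI allI)
  let ?F = "\<lambda>v. int (card (accepting_paths machine v))"
  show "?F \<in> SharpP" unfolding SharpP_def using poly_ntm_guesser by blast
  fix w r
  obtain us where us: "\<And>\<phi>. run_sum (ntm_step machine) \<phi> (init_config machine (pair_unary w r)) =
    (\<Sum>y | length y = guesses w r.
      \<Sum>n\<le>length w + guesses w r.
       run_sum (ntm_step M) (\<lambda>e. \<phi> (sim_conf (pair_unary w r) us
           (True # y @ replicate (length w + guesses w r - n) True) e))
         (init_config M (take n (w @ y))))"
    using guesser_run_sum[of w r] by blast
  show "?F (pair_unary w r) = int (hit_count A w (guesses w r))"
    unfolding card_accepting_eq_run_sum[OF poly_ntm_guesser] us accept_sim_conf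
      card_accepting_eq_run_sum[OF M, symmetric] A hit_count_sum ..
qed

lemma GapP_hit_count:
  assumes A: "\<And>x. int (card (accepting_paths M x)) - int (card (rejecting_paths M x)) = of_bool (x \<in> A)"
  shows "\<exists>F \<in> GapP. \<forall>w r.
    F (pair_unary w r) = int (hit_count A w (guesses w r))"
proof (intro bexI allI)
  let ?F = "\<lambda>v. int (card (accepting_paths machine v)) - int (card (rejecting_paths machine v))"
  show "?F \<in> GapP" unfolding GapP_def using poly_ntm_guesser by blast
  fix w r
  obtain us where us: "\<And>\<phi>. run_sum (ntm_step machine) \<phi> (init_config machine (pair_unary w r)) =
    (\<Sum>y | length y = guesses w r.
      \<Sum>n\<le>length w + guesses w r.
       run_sum (ntm_step M) (\<lambda>e. \<phi> (sim_conf (pair_unary w r) us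
           (True # y @ replicate (length w + guesses w r - n) True) e))
         (init_config M (take n (w @ y))))"
    using guesser_run_sum[of w r] by blast
  show "?F (pair_unary w r) = int (hit_count A w (guesses w r))"
    unfolding gap_eq_run_sum[OF poly_ntm_guesser] us accept_sim_conf
      gap_eq_run_sum[OF M, symmetric] A hit_count_sum ..
qed

text \<open>\<open>M\<close> may accept one prefix on many paths, but all of them print the same
  record of the guesses. Counting distinct outputs therefore counts each pair once.\<close>

lemma SpanP_hit_count:
  assumes A: "\<And>x. x \<in> A \<longleftrightarrow> accepting_paths M x \<noteq> {}"
  shows "\<exists>F \<in> SpanP. \<forall>w r.
    F (pair_unary w r) = int (hit_count A w (guesses w r))"
proof (intro bexI allI)
  let ?O = "\<lambda>v. {z. \<exists>cs \<in> accepting_paths machine v. outputs (last cs) z}"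
  let ?F = "\<lambda>v. int (card (?O v))"
  show "?F \<in> SpanP" unfolding SpanP_def using poly_ntm_guesser by blast
  fix w r
  define k where "k = guesses w r"
  define out where "out y n = True # y @ replicate (length w + k - n) True" for y n
  obtain us where us: "\<And>\<phi>. run_sum (ntm_step machine) \<phi> (init_config machine (pair_unary w r)) =
    (\<Sum>y | length y = k. \<Sum>n\<le>length w + k. run_sum (ntm_step M)
       (\<lambda>e. \<phi> (sim_conf (pair_unary w r) us (out y n) e)) (init_config M (take n (w @ y))))"
    using guesser_run_sum[of w r] unfolding k_def out_def by blast
  have "z \<in> ?O (pair_unary w r) \<longleftrightarrow>
      (\<exists>y n. length y = k \<and> n \<le> length w + k \<and> take n (w @ y) \<in> A \<and> z = out y n)" for z
  proof -
    \<comment> \<open>The existence of an accepting path with output \<open>z\<close> is restated as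
      a nonzero path count, to which the run sum formula applies.\<close>
    have "z \<in> ?O (pair_unary w r) \<longleftrightarrow> {cs \<in> paths machine (pair_unary w r).
        fst (last cs) \<in> accept_states machine \<and> outputs (last cs) z} \<noteq> {}"
      by (auto simp: accepting_paths_def)
    also have "\<dots> \<longleftrightarrow> int (card {cs \<in> paths machine (pair_unary w r).
        fst (last cs) \<in> accept_states machine \<and> outputs (last cs) z}) \<noteq> 0"
      using finite_paths[OF poly_ntm_guesser] by simp
    also have "int (card {cs \<in> paths machine (pair_unary w r).
        fst (last cs) \<in> accept_states machine \<and> outputs (last cs) z}) =
      (\<Sum>y | length y = k. \<Sum>n\<le>length w + k. run_sum (ntm_step M)
       (\<lambda>e. of_bool (fst e \<in> accept_states M \<and> z = out y n)) (init_config M (take n (w @ y))))"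
      unfolding card_paths_eq_run_sum[OF poly_ntm_guesser, where P =
          "\<lambda>e. fst e \<in> accept_states machine \<and> outputs e z"]
        us accept_sim_conf outputs_sim_conf ..
    also have "\<dots> = (\<Sum>y | length y = k. \<Sum>n\<le>length w + k.
        of_bool (z = out y n) * int (card (accepting_paths M (take n (w @ y)))))"
      unfolding card_accepting_eq_run_sum[OF M] by (intro sum.cong refl) (auto simp: run_sum_def)
    also have "\<dots> \<noteq> 0 \<longleftrightarrow> (\<exists>y. length y = k \<and> (\<exists>n\<le>length w + k.
        z = out y n \<and> accepting_paths M (take n (w @ y)) \<noteq> {}))"
      using finite_bits_length[of k "\<lambda>_. True"] finite_paths[OF M]
      by (auto simp: sum_nonneg_eq_0_iff sum_nonneg accepting_paths_def)
    finally show ?thesis using A by blast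
  qed
  then have "?O (pair_unary w r) = case_prod out `
      {(y, n). length y = k \<and> n \<le> length w + k \<and> take n (w @ y) \<in> A}" by auto
  \<comment> \<open>All \<open>y\<close> have length \<open>k\<close>, so the output determines
    \<open>y\<close>, and the number of trailing ones determines n \<le> |w| + k.\<close>
  moreover have "inj_on (case_prod out) {(y, n). length y = k \<and> n \<le> length w + k \<and> take n (w @ y) \<in> A}"
    by (auto simp: inj_on_def out_def) 
  ultimately show "?F (pair_unary w r) = int (hit_count A w (guesses w r))"
    by (simp add: card_image hit_count_def k_def)
qed

end

theorem mainTheorem15:
  fixes X :: "cantor set"
  shows "(M_measure_zero UP X \<longrightarrow> class_measure_zero SharpP X) \<and>
         (M_measure_zero NP X \<longrightarrow> class_measure_zero SpanP X) \<and>
         (M_measure_zero SPP X \<longrightarrow> class_measure_zero GapP X)"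
proof (intro conjI impI)
  assume "M_measure_zero UP X"
  then obtain A M where A: "M_measure_zero {A} X" and M: "poly_ntm M"
    and acc: "\<And>x. x \<in> A \<longleftrightarrow> accepting_paths M x \<noteq> {}" "\<And>x. card (accepting_paths M x) \<le> 1"
    using M_measure_zero_singleton[of UP X] unfolding UP_def by blast
  have "int (card (accepting_paths M x)) = of_bool (x \<in> A)" for x
  proof -
    \<comment> \<open>An infinite set has \<open>card\<close> 0, so finiteness is needed to pass
      from nonempty to nonzero.\<close>
    have "finite (accepting_paths M x)" using finite_paths[OF M] by (simp add: accepting_paths_def)
    then have "card (accepting_paths M x) \<noteq> 0 \<longleftrightarrow> x \<in> A" using acc(1) by simp
    then show ?thesis using acc(2)[of x] by (cases "x \<in> A") auto
  qed
  then show "class_measure_zero SharpP X"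
    by (intro class_measure_zeroI[OF A] SharpP_hit_count[OF _ _ M])
next
  assume "M_measure_zero NP X"
  then obtain A M where A: "M_measure_zero {A} X" and M: "poly_ntm M"
    and acc: "\<And>x. x \<in> A \<longleftrightarrow> accepting_paths M x \<noteq> {}"
    using M_measure_zero_singleton[of NP X] unfolding NP_def by blast
  then show "class_measure_zero SpanP X"
    by (intro class_measure_zeroI[OF A] SpanP_hit_count[OF _ _ M])
next
  assume "M_measure_zero SPP X"
  then obtain A M where A: "M_measure_zero {A} X" and M: "poly_ntm M"
    and gap: "\<And>x. (if x \<in> A then 1 else 0) =
        int (card (accepting_paths M x)) - int (card (rejecting_paths M x))"
    using M_measure_zero_singleton[of SPP X] unfolding SPP_def GapP_def by blast
  have "int (card (accepting_paths M x)) - int (card (rejecting_paths M x)) = of_bool (x \<in> A)" for x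
    unfolding gap[of x, symmetric] by simp
  then show "class_measure_zero GapP X"
    by (intro class_measure_zeroI[OF A] GapP_hit_count[OF _ _ M])
qed

end
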